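(* Let $f\in\mathbb{R}[x]=\mathbb{R}[x_1,\dots,x_n]$ be such that the gradient ideal $\mathcal{I}_{\nabla}(f)$ is zero-dimensional and $\det(\nabla^2f)$ has no roots on $V_{\mathbb{R}}(\mathcal{I}_{\nabla}(f))$. On input $f$, Algorithm GRULOM terminates and returns the set of all local minimizers of $f$ over $\mathbb{R}^n$.
   Context: The gradient ideal $\mathcal{I}_{\nabla}(f)$ is generated by all partial derivatives of $f$; $V_{\mathbb{C}}(\mathcal{I})$ and $V_{\mathbb{R}}(\mathcal{I})$ denote the sets of complex and real common zeros of an ideal $\mathcal{I}$; $\mathcal{I}$ is zero-dimensional if $V_{\mathbb{C}}(\mathcal{I})$ is finite. $\nabla^2 f$ is the Hessian matrix; $\mathrm{rad}(\mathcal{I})$ is the radical of $\mathcal{I}$ in the real polynomial ring; $Q\succ0$ means that the symmetric real matrix $Q$ is positive definite. A local minimizer of $f$ over $\mathbb{R}^n$ is a point $u$ for which there is $\varepsilon>0$ with $f(u)\le f(x)$ whenever $\|x-u\|<\varepsilon$. Algorithm GRULOM (exact arithmetic over $\mathbb{R}$). Input: $f$. (1) Set $j:=0$ and shape $:=$ false. (2) While shape $=$ false, do (3)--(5): (3) Let $A$ be the $n\times n$ matrix whose first row is $(1,j,j^2,\dots,j^{n-1})$ and whose other rows are those of the identity matrix; set $g(y):=f(A^{-1}y)$. (4) Compute $\mathrm{rad}(\mathcal{I}_{\nabla}(g))$ in $\mathbb{R}[y_1,\dots,y_n]$ and its reduced Gröbner basis $G$ with respect to the lexicographic monomial ordering $y_1<\cdots<y_n$.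 (5) If $G$ has the form $\{w,y_2-v_2,\dots,y_n-v_n\}$ with $w,v_2,\dots,v_n\in\mathbb{R}[y_1]$, set shape $:=$ true; else set $j:=j+1$. Write $v(t):=(t,v_2(t),\dots,v_n(t))$. (6) Compute $\tilde H(t):=\nabla^2g(v(t))$ and $H(t):=\tilde H(t)\bmod w(t)$, i.e. the entrywise remainders on division by $w$. (7) Return the set $\{A^{-1}(v(t)): w(t)=0,\ t\in\mathbb{R},\ H(t)\succ0\}$.
   Formalization: For n ≥ 2 the formal theorem also assumes that the gradient ideal has at least one complex zero; without this the claim fails (for f = x_1 the reduced Gröbner basis is always {1}, so the algorithm never terminates). *)

theory Defs
  imports
    "HOL-Analysis.Analysis"
    "HOL-Computational_Algebra.Polynomial"
    "HOL-Library.Poly_Mapping"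
    "HOL-Library.While_Combinator"
begin

section \<open>Polynomials in finitely many ordered variables\<close>

text \<open>
  The variables are indexed by a finite linearly ordered type \<open>'n\<close>, so that \<open>n\<close> is
  \<open>CARD('n)\<close> and the listing \<open>x\<^sub>1, \<dots>, x\<^sub>n\<close> is the increasing enumeration of \<open>'n\<close>.
  A monomial is its exponent vector; a polynomial maps monomials to their coefficients, and
  multiplication is the convolution product of \<^theory>\<open>HOL-Library.Poly_Mapping\<close>.
\<close>

type_synonym 'n monom = "'n \<Rightarrow>\<^sub>0 nat"
type_synonym 'n rpoly = "'n monom \<Rightarrow>\<^sub>0 real"

text \<open>\<^theory>\<open>HOL-Library.Poly_Mapping\<close> hides these names.\<close>

abbreviation "lookup \<equiv> Poly_Mapping.lookup"
abbreviation "keys \<equiv> Poly_Mapping.keys"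
abbreviation "single \<equiv> Poly_Mapping.single"

definition Const :: "real \<Rightarrow> 'n rpoly" where
  "Const a = single 0 a"

definition Var :: "'n \<Rightarrow> 'n rpoly" where
  "Var i = single (single i 1) 1"

text \<open>
  Evaluation in an arbitrary commutative ring, where \<open>c\<close> embeds the coefficients; it covers
  real and complex points as well as substitution of polynomials.
\<close>

definition meval :: "(real \<Rightarrow> 'b::comm_ring_1) \<Rightarrow> 'b ^ 'n \<Rightarrow> 'n::finite rpoly \<Rightarrow> 'b" where
  "meval c x p = (\<Sum>m\<in>keys p. c (lookup p m) * (\<Prod>i\<in>UNIV. x $ i ^ lookup m i))"

abbreviation eval_real :: "'n::finite rpoly \<Rightarrow> real ^ 'n \<Rightarrow> real" where
  "eval_real p x \<equiv> meval (\<lambda>a. a) x p"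

abbreviation eval_complex :: "'n::finite rpoly \<Rightarrow> complex ^ 'n \<Rightarrow> complex" where
  "eval_complex p z \<equiv> meval complex_of_real z p"

text \<open>For an exponent \<open>lookup m i = 0\<close> the subtraction truncates, but the coefficient is \<open>0\<close>.\<close>

definition partial_deriv :: "'n \<Rightarrow> 'n rpoly \<Rightarrow> 'n rpoly" where
  "partial_deriv i p = (\<Sum>m\<in>keys p.
     single (m - single i 1) (of_nat (lookup m i) * lookup p m))"

definition hessian :: "'n::finite rpoly \<Rightarrow> ('n rpoly) ^ 'n ^ 'n" where
  "hessian f = (\<chi> i k. partial_deriv i (partial_deriv k f))"


section \<open>Ideals and their zero sets\<close>

lemma module_times: "module ((*) :: 'a::comm_ring_1 \<Rightarrow> 'a \<Rightarrow> 'a)"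
  by unfold_locales (simp_all add: algebra_simps)

definition ideal :: "'a::comm_ring_1 set \<Rightarrow> 'a set" where
  "ideal B = module.span (*) B"

definition radical :: "'a::comm_ring_1 set \<Rightarrow> 'a set" where
  "radical I = {p. \<exists>k>0. p ^ k \<in> I}"

definition gradient_ideal :: "'n rpoly \<Rightarrow> 'n rpoly set" where
  "gradient_ideal f = ideal {partial_deriv i f |i. True}"

definition V_real :: "'n::finite rpoly set \<Rightarrow> (real ^ 'n) set" where
  "V_real I = {x. \<forall>p\<in>I. eval_real p x = 0}"

definition V_complex :: "'n::finite rpoly set \<Rightarrow> (complex ^ 'n) set" where
  "V_complex I = {z. \<forall>p\<in>I. eval_complex p z = 0}"

definition zero_dimensional :: "'n::finite rpoly set \<Rightarrow> bool" where
  "zero_dimensional I \<longleftrightarrow> finite (V_complex I)"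


section \<open>Lexicographic reduced Groebner bases\<close>

text \<open>
  As \<open>y\<^sub>1 < \<dots> < y\<^sub>n\<close>, exponents are compared first at the largest index. This differs from the
  order instance of \<^theory>\<open>HOL-Library.Poly_Mapping\<close>, where the smallest index decides.
\<close>

definition lex_less :: "'n::linorder monom \<Rightarrow> 'n monom \<Rightarrow> bool" where
  "lex_less s t \<longleftrightarrow> (\<exists>i. lookup s i < lookup t i \<and> (\<forall>k>i. lookup s k = lookup t k))"

definition lead_monomial :: "'n::linorder rpoly \<Rightarrow> 'n monom" where
  "lead_monomial p = (THE m. m \<in> keys p \<and> (\<forall>m'\<in>keys p. m' \<noteq> m \<longrightarrow> lex_less m' m))"

definition lead_coefficient :: "'n::linorder rpoly \<Rightarrow> real" where
  "lead_coefficient p = lookup p (lead_monomial p)"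

definition lead_term :: "'n::linorder rpoly \<Rightarrow> 'n rpoly" where
  "lead_term p = single (lead_monomial p) (lead_coefficient p)"

definition lead_ideal :: "'n::linorder rpoly set \<Rightarrow> 'n rpoly set" where
  "lead_ideal S = ideal (lead_term ` (S - {0}))"

definition groebner_basis :: "'n::linorder rpoly set \<Rightarrow> 'n rpoly set \<Rightarrow> bool" where
  "groebner_basis I G \<longleftrightarrow> finite G \<and> G \<subseteq> I \<and> lead_ideal G = lead_ideal I"

definition reduced_groebner_basis :: "'n::linorder rpoly set \<Rightarrow> 'n rpoly set \<Rightarrow> bool" where
  "reduced_groebner_basis I G \<longleftrightarrow> groebner_basis I G \<and>
     (\<forall>p\<in>G. lead_coefficient p = 1 \<and>
       (\<forall>m\<in>keys p. single m 1 \<notin> lead_ideal (G - {p})))"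

definition the_reduced_groebner_basis :: "'n::linorder rpoly set \<Rightarrow> 'n rpoly set" where
  "the_reduced_groebner_basis I = (THE G. reduced_groebner_basis I G)"


section \<open>The algorithm\<close>

definition pos_def :: "real ^ 'n ^ 'n \<Rightarrow> bool" where
  "pos_def Q \<longleftrightarrow> transpose Q = Q \<and> (\<forall>x. x \<noteq> 0 \<longrightarrow> x \<bullet> (Q *v x) > 0)"

definition local_minimizer :: "'n::finite rpoly \<Rightarrow> real ^ 'n \<Rightarrow> bool" where
  "local_minimizer f u \<longleftrightarrow>
     (\<exists>\<epsilon>>0. \<forall>x. norm (x - u) < \<epsilon> \<longrightarrow> eval_real f u \<le> eval_real f x)"

definition first_var :: "'n::{finite,linorder}" where
  "first_var = Min UNIV"

text \<open>\<open>card {..<k}\<close> is the position of \<open>k\<close> in the enumeration of \<open>'n\<close>, counted from \<open>0\<close>.\<close>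

definition transf_matrix :: "nat \<Rightarrow> real ^ 'n::{finite,linorder} ^ 'n::{finite,linorder}" where
  "transf_matrix j = (\<chi> i k. if i = first_var then real j ^ card {..<k} else mat 1 $ i $ k)"

text \<open>The polynomial \<open>f(A\<^sup>-\<^sup>1 y)\<close> in the variables \<open>y\<close>:\<close>

definition transform :: "real ^ 'n ^ 'n \<Rightarrow> 'n::finite rpoly \<Rightarrow> 'n rpoly" where
  "transform A f = meval Const (map_matrix Const (matrix_inv A) *v (\<chi> i. Var i)) f"

definition basis_at :: "'n::{finite,linorder} rpoly \<Rightarrow> nat \<Rightarrow> 'n rpoly set" where
  "basis_at f j =
     the_reduced_groebner_basis (radical (gradient_ideal (transform (transf_matrix j) f)))"

text \<open>Univariate polynomials, seen as polynomials in the first variable:\<close>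

definition in_first_var :: "real poly \<Rightarrow> 'n::{finite,linorder} rpoly" where
  "in_first_var q = (\<Sum>k\<le>degree q. Const (coeff q k) * Var first_var ^ k)"

text \<open>
  \<open>G = {w, y\<^sub>2 - v\<^sub>2, \<dots>, y\<^sub>n - v\<^sub>n}\<close>; the component of \<open>v\<close> at the first index is the
  indeterminate, so that \<open>v\<close> is the vector \<open>v(t) = (t, v\<^sub>2(t), \<dots>, v\<^sub>n(t))\<close>.
\<close>

definition has_shape ::
    "'n::{finite,linorder} rpoly set \<Rightarrow> real poly \<Rightarrow> (real poly) ^ 'n::{finite,linorder} \<Rightarrow> bool" where
  "has_shape G w v \<longleftrightarrow> v $ first_var = [:0, 1:] \<and>
     G = insert (in_first_var w) ((\<lambda>i. Var i - in_first_var (v $ i)) ` (- {first_var}))"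

text \<open>
  The loop state is the pair \<open>(j, shape)\<close>; nontermination of the loop is the result \<open>None\<close>.
  A pitfall: if the gradient ideal is the whole ring, then so is its transform, whose reduced
  Groebner basis is \<open>{1}\<close>. For \<open>n \<ge> 2\<close> this is not of the form \<open>{w, y\<^sub>2 - v\<^sub>2, \<dots>, y\<^sub>n - v\<^sub>n}\<close>
  (see \<open>not_has_shape_one\<close> below), whatever \<open>j\<close> is, and the loop does not terminate.
\<close>

definition GRULOM :: "'n::{finite,linorder} rpoly \<Rightarrow> (real ^ 'n::{finite,linorder}) set option" where
  "GRULOM f =
    map_option
      (\<lambda>(j, shape).
        let A = transf_matrix j;
            g = transform A f;
            (w, v) = (SOME (w, v). has_shape (basis_at f j) w v);
            H' = map_matrix (meval (\<lambda>a. [:a:]) v) (hessian g);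
            H = map_matrix (\<lambda>h. h mod w) H'
        in {matrix_inv A *v (\<chi> i. poly (v $ i) t) |t.
              poly w t = 0 \<and> pos_def (map_matrix (\<lambda>h. poly h t) H)})
      (while_option
        (\<lambda>(j, shape). \<not> shape)
        (\<lambda>(j, shape). if \<exists>w v. has_shape (basis_at f j) w v then (j, True) else (j + 1, shape))
        (0, False))"

lemma lookup_in_first_var:
  assumes "i \<noteq> first_var"
  shows "lookup (in_first_var q) (single i 1) = 0"
proof -
  have pow: "Var first_var ^ k = (single (single first_var k) 1 :: 'a rpoly)"
    for k
    by (induction k) (simp_all add: Var_def mult_single flip: single_add)
  have "single first_var k \<noteq> single i (1::nat)" for k
    using assms by (metis lookup_single_eq lookup_single_not_eq one_neq_zero)
  then show ?thesis
    by (simp add: in_first_var_def lookup_sum pow Const_def mult_single lookup_single)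
qed

lemma not_has_shape_one:
  assumes "CARD('n::{finite,linorder}) \<ge> 2"
  shows "\<not> has_shape {1 :: 'n rpoly} w v"
proof
  assume *: "has_shape {1 :: 'n rpoly} w v"
  have "UNIV \<noteq> {first_var :: 'n}"
    using assms by (metis One_nat_def card.empty card.insert empty_iff finite.emptyI not_less_eq_eq
      numeral_2_eq_2 order_refl)
  then obtain i :: 'n where i: "i \<noteq> first_var" by auto
  then have "Var i - in_first_var (v $ i) = 1"
    using * unfolding has_shape_def by blast
  then have "lookup (Var i - in_first_var (v $ i)) (single i 1) =
      lookup (1 :: 'n rpoly) (single i 1)" by simp
  moreover have "single i 1 \<noteq> (0 :: 'n monom)"
    by (metis lookup_single_eq lookup_zero one_neq_zero)
  ultimately show False
    by (simp add: lookup_minus lookup_in_first_var[OF i] Var_def lookup_one when_def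
        del: One_nat_def)
qed

end

theory Submission
  imports Defs "HOL-Computational_Algebra.Fundamental_Theorem_Algebra"
begin

text \<open>
  For all but finitely many \<open>j\<close> the first coordinates of the finitely many complex zeros of the
  transformed gradient ideal are pairwise distinct. By the Nullstellensatz, the radical then
  contains \<open>y\<^sub>i - v\<^sub>i\<close> for real interpolation polynomials \<open>v\<^sub>i\<close>, so that the reduced Groebner basis
  has the required shape and the loop terminates. Whichever \<open>j\<close> the loop stops at, the basis
  generates the radical: the real roots of \<open>w\<close> parametrize the real critical points, and there
  \<open>H(t)\<close> is congruent to the Hessian matrix of \<open>f\<close>. As this is nonsingular at all critical points,
  the local minimizers are exactly the critical points at which it is positive definite.
\<close>

section \<open>Ring homomorphisms and evaluation\<close>

text \<open>The reduced basis enters the algorithm through a definite description, so both existence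
  and uniqueness are needed: uniqueness identifies the explicit candidate built at a separating
  \<open>j\<close>, and existence makes the basis at an unknown stopping \<open>j\<close> generate
  the radical.

  The radical is taken over the reals while zeros are counted over the complex numbers. The
  Nullstellensatz is therefore proved by complexifying the ideal. Instead of adjoining an inverse of
  \<open>p\<close> as a new variable, it uses an ideal maximal among those containing no power of
  \<open>p\<close>, so that the variables remain indexed by \<open>'n\<close>. Conjugation symmetry
  of the zero set brings the interpolation polynomials back to real coefficients.

  If n \<ge> 2 and there are no complex critical points, the reduced basis is \<open>{1}\<close> for
  every \<open>j\<close> and the loop never ends; the hypothesis on \<open>CARD('n)\<close> excludes
  this case. For one variable, \<open>{1}\<close> has the required shape with
  \<open>w = 1\<close>.\<close>

locale comm_ring_hom =
  fixes h :: "'a::comm_ring_1 \<Rightarrow> 'b::comm_ring_1"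
  assumes hom_add: "h (x + y) = h x + h y"
    and hom_mult: "h (x * y) = h x * h y"
    and hom_one: "h 1 = 1"
begin

lemma hom_zero: "h 0 = 0"
  using hom_add[of 0 0] by simp

lemma hom_uminus: "h (- x) = - h x"
  by (metis add.right_inverse hom_add hom_zero minus_unique)

lemma hom_minus: "h (x - y) = h x - h y"
  by (metis diff_conv_add_uminus hom_add hom_uminus)

lemma hom_power: "h (x ^ k) = h x ^ k"
  by (induction k) (simp_all add: hom_one hom_mult)

lemma hom_sum: "h (sum f S) = (\<Sum>i\<in>S. h (f i))"
  by (induction S rule: infinite_finite_induct) (simp_all add: hom_zero hom_add)

lemma hom_prod: "h (prod f S) = (\<Prod>i\<in>S. h (f i))"
  by (induction S rule: infinite_finite_induct) (simp_all add: hom_one hom_mult)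

lemma hom_of_int: "h (of_int k) = of_int k"
proof -
  have nat: "h (of_nat n) = of_nat n" for n
    by (induction n) (simp_all add: hom_zero hom_one hom_add)
  show ?thesis
    by (cases k) (simp_all add: nat hom_uminus hom_minus hom_one)
qed

lemma hom_det: "h (det A) = det (map_matrix h A)"
  by (simp add: det_def hom_sum hom_mult hom_of_int hom_prod)

end

section \<open>Induction principles for polynomials\<close>

lemma poly_mapping_eq_sum: "p = (\<Sum>m\<in>keys p. single m (lookup p m))"
  for p :: "'a \<Rightarrow>\<^sub>0 'b::comm_monoid_add"
proof (rule poly_mapping_eqI)
  fix k
  have "(\<Sum>m\<in>keys p. lookup p m when m = k) = (if k \<in> keys p then lookup p k else 0)"
    by (simp add: when_def sum.delta)
  then show "lookup p k = lookup (\<Sum>m\<in>keys p. single m (lookup p m)) k"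
    by (simp add: lookup_sum lookup_single in_keys_iff)
qed

text \<open>Reduces additive identities, such as multiplicativity of evaluation in either factor, to
  single terms. Zero is covered as a term with coefficient 0.\<close>

lemma poly_mapping_add_induct [case_names single add]:
  fixes p :: "'a \<Rightarrow>\<^sub>0 'b::comm_monoid_add"
  assumes single: "\<And>m a. P (single m a)"
    and add: "\<And>p q. P p \<Longrightarrow> P q \<Longrightarrow> P (p + q)"
  shows "P p"
proof -
  have "P (\<Sum>m\<in>S. single m (lookup p m))" if "finite S" for S
    using that
  proof induction
    case empty
    show ?case using single[of undefined 0] by simp
  qed (simp_all add: single add)
  then show ?thesis by (metis finite_keys poly_mapping_eq_sum)
qed

lemma single_eq_prod:
  "single m a = single 0 a * (\<Prod>i\<in>UNIV. single (single i 1) 1 ^ lookup m i)"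
  for m :: "'n::finite monom" and a :: "'a::comm_semiring_1"
proof -
  have pow: "single (single i 1) (1::'a) ^ k = single (single i k) 1" for i :: 'n and k
    by (induction k) (simp_all add: mult_single flip: single_add)
  have "(\<Prod>i\<in>S. single (single i 1) 1 ^ lookup m i)
      = single (\<Sum>i\<in>S. single i (lookup m i)) (1::'a)" if "finite S" for S
    using that by induction (simp_all add: pow mult_single del: One_nat_def)
  moreover have "(\<Sum>i\<in>UNIV. single i (lookup m i)) = m"
    by (rule poly_mapping_eqI) (simp add: lookup_sum lookup_single when_def)
  ultimately show ?thesis
    by (simp add: mult_single)
qed

text \<open>By \<open>single_eq_prod\<close>, constants and variables generate the polynomial ring.
  This form suits statements compatible with products, such as the chain rule, and keeps exponents
  out of sight.\<close>

lemma mpoly_induct [case_names Const Var add mult]: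
  fixes p :: "'n::finite rpoly"
  assumes Const: "\<And>a. P (Const a)"
    and Var: "\<And>i. P (Var i)"
    and add: "\<And>p q. P p \<Longrightarrow> P q \<Longrightarrow> P (p + q)"
    and mult: "\<And>p q. P p \<Longrightarrow> P q \<Longrightarrow> P (p * q)"
  shows "P p"
proof (induction p rule: poly_mapping_add_induct)
  case (single m a)
  have one: "P 1" using Const[of 1] by (simp add: Const_def)
  have pow: "P (Var i ^ k)" for i k
    by (induction k) (simp_all add: one mult Var)
  have "P (\<Prod>i\<in>S. Var i ^ lookup m i)" if "finite S" for S
    using that by induction (simp_all add: one mult pow)
  then show ?case
    unfolding single_eq_prod[of m a] using mult Const unfolding Const_def Var_def by simp
qed (rule add)

lemma Const_0 [simp]: "Const 0 = 0"
  and Const_1 [simp]: "Const 1 = 1"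
  and Const_add: "Const (a + b) = Const a + Const b"
  and Const_mult: "Const (a * b) = Const a * Const b"
  by (simp_all add: Const_def single_add mult_single)

interpretation Const: comm_ring_hom "Const :: real \<Rightarrow> 'n rpoly"
  by unfold_locales (simp_all add: Const_add Const_mult)

section \<open>Evaluation as a ring homomorphism\<close>

context
  fixes c :: "real \<Rightarrow> 'b::comm_ring_1"
  assumes c: "comm_ring_hom c"
begin

interpretation c: comm_ring_hom c by (rule c)

lemma meval_single: "meval c x (single m a) = c a * (\<Prod>i\<in>UNIV. x $ i ^ lookup m i)"
  by (simp add: meval_def c.hom_zero)

lemma meval_Const: "meval c x (Const a) = c a"
  by (simp add: Const_def meval_single)

lemma meval_Var: "meval c x (Var i) = x $ i"
proof -
  have "(\<Prod>k\<in>UNIV. x $ k ^ lookup (single i 1) k) = (\<Prod>k\<in>UNIV. if k = i then x $ k else 1)"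
    by (intro prod.cong) (auto simp: lookup_single)
  then show ?thesis
    by (simp add: Var_def meval_single c.hom_one del: One_nat_def)
qed

lemma meval_add: "meval c x (p + q) = meval c x p + meval c x q"
  unfolding meval_def
  by (rule setsum_keys_plus_distrib) (simp_all add: c.hom_zero c.hom_add distrib_right)

lemma meval_mult: "meval c x (p * q) = meval c x p * meval c x q"
proof (induction p rule: poly_mapping_add_induct)
  case (single m a)
  show ?case
  proof (induction q rule: poly_mapping_add_induct)
    case (single n b)
    show ?case
      by (simp add: mult_single meval_single c.hom_mult lookup_add power_add prod.distrib)
  qed (simp add: distrib_left meval_add)
qed (simp add: distrib_right meval_add)

lemma comm_ring_hom_meval: "comm_ring_hom (meval c x)"
  using meval_Const[of x 1]
  by unfold_locales (simp_all add: meval_add meval_mult c.hom_one)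

end

lemma comm_ring_hom_id: "comm_ring_hom (\<lambda>a. a)"
  by unfold_locales simp_all

lemma comm_ring_hom_of_real: "comm_ring_hom complex_of_real"
  by unfold_locales simp_all

lemma comm_ring_hom_poly_const: "comm_ring_hom (\<lambda>a. [:a:])"
  by unfold_locales (simp_all add: one_pCons)

lemma comm_ring_hom_Const: "comm_ring_hom Const"
  by (rule Const.comm_ring_hom_axioms)

interpretation eval_real: comm_ring_hom "\<lambda>p. eval_real p x"
  by (rule comm_ring_hom_meval[OF comm_ring_hom_id])

interpretation eval_complex: comm_ring_hom "\<lambda>p. eval_complex p x"
  by (rule comm_ring_hom_meval[OF comm_ring_hom_of_real])

lemmas eval_real_simps =
  eval_real.hom_add eval_real.hom_mult eval_real.hom_minus eval_real.hom_uminus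
  eval_real.hom_sum eval_real.hom_power eval_real.hom_zero eval_real.hom_one
  meval_Const[OF comm_ring_hom_id] meval_Var[OF comm_ring_hom_id]

lemmas eval_complex_simps =
  eval_complex.hom_add eval_complex.hom_mult eval_complex.hom_minus eval_complex.hom_uminus
  eval_complex.hom_sum eval_complex.hom_power eval_complex.hom_zero eval_complex.hom_one
  meval_Const[OF comm_ring_hom_of_real] meval_Var[OF comm_ring_hom_of_real]

text \<open>Serves to conjugate a complex zero, to evaluate a substituted polynomial
  (\<open>transform\<close>), and to evaluate the Hessian along \<open>v\<close> at a root of
  \<open>w\<close>.\<close>

lemma hom_meval:
  fixes c :: "real \<Rightarrow> 'a::comm_ring_1"
  assumes c: "comm_ring_hom c" and h: "comm_ring_hom h"
  shows "h (meval c x p) = meval (\<lambda>a. h (c a)) (\<chi> i. h (x $ i)) p"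
proof -
  interpret h: comm_ring_hom h by (rule h)
  show ?thesis
    by (simp add: meval_def h.hom_sum h.hom_mult h.hom_prod h.hom_power)
qed

section \<open>Ideals and radicals\<close>

lemma ideal_0: "0 \<in> ideal B"
  and ideal_base: "b \<in> B \<Longrightarrow> b \<in> ideal B"
  and ideal_add: "p \<in> ideal B \<Longrightarrow> q \<in> ideal B \<Longrightarrow> p + q \<in> ideal B"
  and ideal_mult: "p \<in> ideal B \<Longrightarrow> r * p \<in> ideal B"
  unfolding ideal_def
  using module.span_zero[OF module_times] module.span_base[OF module_times]
    module.span_add[OF module_times] module.span_scale[OF module_times] by blast+

lemma ideal_induct [consumes 1, case_names zero base add mult]:
  assumes "p \<in> ideal B"
    and "P 0" "\<And>b. b \<in> B \<Longrightarrow> P b" "\<And>p q. P p \<Longrightarrow> P q \<Longrightarrow> P (p + q)" "\<And>r p. P p \<Longrightarrow> P (r * p)"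
  shows "P p"
  using assms(1) unfolding ideal_def
  by (rule module.span_induct_alt[OF module_times]) (simp_all add: assms)

text \<open>Radicals, unions of chains and sums of ideals come without a set of generators, so the
  closure properties are stated for an arbitrary set rather than for \<open>ideal B\<close>.\<close>

definition is_ideal :: "'a::comm_ring_1 set \<Rightarrow> bool" where
  "is_ideal I \<longleftrightarrow> 0 \<in> I \<and> (\<forall>p\<in>I. \<forall>q\<in>I. p + q \<in> I) \<and> (\<forall>r. \<forall>p\<in>I. r * p \<in> I)"

lemma is_idealI:
  assumes "0 \<in> I" "\<And>p q. p \<in> I \<Longrightarrow> q \<in> I \<Longrightarrow> p + q \<in> I" "\<And>r p. p \<in> I \<Longrightarrow> r * p \<in> I"
  shows "is_ideal I"
  using assms by (auto simp: is_ideal_def)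

context
  fixes I :: "'a::comm_ring_1 set"
  assumes I: "is_ideal I"
begin

lemma is_ideal_0: "0 \<in> I"
  and is_ideal_add: "p \<in> I \<Longrightarrow> q \<in> I \<Longrightarrow> p + q \<in> I"
  and is_ideal_mult: "p \<in> I \<Longrightarrow> r * p \<in> I"
  and is_ideal_mult': "p \<in> I \<Longrightarrow> p * r \<in> I"
  using I by (auto simp: is_ideal_def mult.commute[of p])

lemma is_ideal_uminus: "p \<in> I \<Longrightarrow> - p \<in> I"
  using is_ideal_mult[of p "- 1"] by simp

lemma is_ideal_minus: "p \<in> I \<Longrightarrow> q \<in> I \<Longrightarrow> p - q \<in> I"
  using is_ideal_add[of p "- q"] is_ideal_uminus[of q] by simp

lemma is_ideal_sum: "(\<And>i. i \<in> S \<Longrightarrow> g i \<in> I) \<Longrightarrow> sum g S \<in> I"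
  by (induction S rule: infinite_finite_induct) (auto intro: is_ideal_0 is_ideal_add)

lemma is_ideal_cong: "p - q \<in> I \<Longrightarrow> p \<in> I \<longleftrightarrow> q \<in> I"
  using is_ideal_add[of "p - q" q] is_ideal_minus[of p "p - q"] by auto

lemma ideal_subset: "B \<subseteq> I \<Longrightarrow> ideal B \<subseteq> I"
  by (auto elim: ideal_induct intro: is_ideal_0 is_ideal_add is_ideal_mult)

lemma is_ideal_radical: "is_ideal (radical I)"
proof (rule is_idealI)
  show "0 \<in> radical I"
    unfolding radical_def using is_ideal_0 by (auto intro!: exI[of _ 1])
next
  fix p q assume "p \<in> radical I" "q \<in> radical I"
  then obtain k l where k: "k > 0" "p ^ k \<in> I" and l: "l > 0" "q ^ l \<in> I"
    by (auto simp: radical_def)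
  \<comment> \<open>In each binomial term either the exponent of \<open>p\<close> reaches
    \<open>k\<close> or that of \<open>q\<close> exceeds \<open>l\<close>, so one factor already
    lies in \<open>I\<close>.\<close>
  have "of_nat ((k + l) choose i) * p ^ i * q ^ (k + l - i) \<in> I" for i
  proof (cases "i \<ge> k")
    case True
    then have "p ^ i = p ^ k * p ^ (i - k)" by (simp flip: power_add)
    then show ?thesis
      using k(2) by (simp add: is_ideal_mult is_ideal_mult')
  next
    case False
    then have "q ^ (k + l - i) = q ^ l * q ^ (k - i)" by (simp add: add.commute flip: power_add)
    then show ?thesis
      using l(2) by (simp add: is_ideal_mult is_ideal_mult')
  qed
  then have "(p + q) ^ (k + l) \<in> I"
    by (simp add: binomial_ring is_ideal_sum)
  then show "p + q \<in> radical I"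
    unfolding radical_def using k(1) by (auto intro!: exI[of _ "k + l"])
next
  fix r p assume "p \<in> radical I"
  then show "r * p \<in> radical I"
    unfolding radical_def by (auto simp: power_mult_distrib is_ideal_mult)
qed

end

lemma is_ideal_ideal: "is_ideal (ideal B)"
  by (rule is_idealI) (auto intro: ideal_0 ideal_add ideal_mult)

lemma subset_radical: "I \<subseteq> radical I"
  unfolding radical_def by (auto intro!: exI[of _ 1])

lemma V_complex_ideal: "V_complex (ideal B) = {z. \<forall>p\<in>B. eval_complex p z = 0}"
proof -
  have "eval_complex p z = 0" if "p \<in> ideal B" "\<forall>p\<in>B. eval_complex p z = 0" for p z
    using that by (induction rule: ideal_induct) (auto simp: eval_complex_simps)
  then show ?thesis
    by (auto simp: V_complex_def ideal_base)
qed

lemma V_real_ideal: "V_real (ideal B) = {x. \<forall>p\<in>B. eval_real p x = 0}"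
proof -
  have "eval_real p x = 0" if "p \<in> ideal B" "\<forall>p\<in>B. eval_real p x = 0" for p x
    using that by (induction rule: ideal_induct) (auto simp: eval_real_simps)
  then show ?thesis
    by (auto simp: V_real_def ideal_base)
qed

text \<open>In an integral domain an element with a vanishing power is 0. Stated for homomorphisms
  so that it covers real and complex evaluation alike.\<close>

lemma hom_eq_0_on_radical:
  fixes h :: "'a::comm_ring_1 \<Rightarrow> 'b::idom"
  assumes h: "comm_ring_hom h" "\<And>p. p \<in> I \<Longrightarrow> h p = 0" and p: "p \<in> radical I"
  shows "h p = 0"
proof -
  obtain k where "p ^ k \<in> I" using p by (auto simp: radical_def)
  then have "h p ^ k = 0"
    using h(2)[of "p ^ k"] by (simp add: comm_ring_hom.hom_power[OF h(1)])
  then show ?thesis by simp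
qed

lemma V_real_radical: "V_real (radical I) = V_real I"
  using subset_radical[of I] hom_eq_0_on_radical[OF eval_real.comm_ring_hom_axioms, of I]
  unfolding V_real_def by blast

lemma V_complex_radical: "V_complex (radical I) = V_complex I"
  using subset_radical[of I] hom_eq_0_on_radical[OF eval_complex.comm_ring_hom_axioms, of I]
  unfolding V_complex_def by blast

section \<open>The Nullstellensatz\<close>

context comm_ring_hom
begin

lemma map_poly_hom_add: "map_poly h (p + q) = map_poly h p + map_poly h q"
  by (rule poly_eqI) (simp add: coeff_map_poly hom_zero hom_add)

lemma map_poly_hom_smult: "map_poly h (smult a q) = smult (h a) (map_poly h q)"
  by (rule poly_eqI) (simp add: coeff_map_poly hom_zero hom_mult)

lemma map_poly_hom_pCons: "map_poly h (pCons a p) = pCons (h a) (map_poly h p)"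
  by (rule poly_eqI) (simp add: coeff_map_poly hom_zero coeff_pCons split: nat.split)

lemma map_poly_hom_mult: "map_poly h (p * q) = map_poly h p * map_poly h q"
  by (induction p) (simp_all add: map_poly_hom_add map_poly_hom_smult map_poly_hom_pCons hom_zero)

text \<open>Its instances include the embedding \<open>in_first_var\<close>, with
  \<open>Const\<close> and the first variable, and the substitution of a multivariate
  \<open>x\<close> into complex univariate polynomials.\<close>

lemma comm_ring_hom_poly_map_poly: "comm_ring_hom (\<lambda>p. poly (map_poly h p) x)"
  by unfold_locales
    (simp_all add: map_poly_hom_add map_poly_hom_mult map_poly_hom_pCons hom_one one_pCons)

end

text \<open>Zorn's lemma on the ideals above \<open>I\<close> that contain no power of
  \<open>p\<close>. Such an ideal becomes maximal once \<open>p\<close> is inverted; the last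
  conclusion expresses this without forming the localization, since every \<open>u\<close> outside
  \<open>M\<close> divides some power of \<open>p\<close> modulo \<open>M\<close>.\<close>

lemma exists_maximal_avoiding_powers:
  assumes I: "is_ideal I" and p: "\<And>k. p ^ k \<notin> I"
  obtains M where "is_ideal M" "I \<subseteq> M" "\<And>k. p ^ k \<notin> M"
    "\<And>u. u \<notin> M \<Longrightarrow> \<exists>k r. p ^ k - r * u \<in> M"
proof -
  define \<A> where "\<A> = {J. is_ideal J \<and> I \<subseteq> J \<and> (\<forall>k. p ^ k \<notin> J)}"
  have "\<exists>M\<in>\<A>. \<forall>X\<in>\<A>. M \<subseteq> X \<longrightarrow> X = M"
  proof (rule subset_Zorn_nonempty)
    show "\<A> \<noteq> {}" using assms by (auto simp: \<A>_def)
  next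
    fix \<C> assume ne: "\<C> \<noteq> {}" and ch: "subset.chain \<A> \<C>"
    have sub: "\<C> \<subseteq> \<A>" and tot: "\<And>X Y. X \<in> \<C> \<Longrightarrow> Y \<in> \<C> \<Longrightarrow> X \<subseteq> Y \<or> Y \<subseteq> X"
      using ch by (auto simp: subset_chain_def)
    have id: "is_ideal X" if "X \<in> \<C>" for X using that sub by (auto simp: \<A>_def)
    have "is_ideal (\<Union>\<C>)"
    proof (rule is_idealI)
      show "0 \<in> \<Union>\<C>" using ne id is_ideal_0 by blast
    next
      fix a b assume "a \<in> \<Union>\<C>" "b \<in> \<Union>\<C>"
      then obtain X Y where "X \<in> \<C>" "Y \<in> \<C>" "a \<in> X" "b \<in> Y" by blast
      with tot[of X Y] show "a + b \<in> \<Union>\<C>"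
        by (meson UnionI id is_ideal_add subsetD)
    next
      fix r a assume "a \<in> \<Union>\<C>"
      then show "r * a \<in> \<Union>\<C>" using id is_ideal_mult by blast
    qed
    then show "\<Union>\<C> \<in> \<A>"
      using ne sub by (auto simp: \<A>_def)
  qed
  then obtain M where M: "M \<in> \<A>" and max: "\<And>X. X \<in> \<A> \<Longrightarrow> M \<subseteq> X \<Longrightarrow> X = M" by blast
  have idM: "is_ideal M" using M by (simp add: \<A>_def)
  have "\<exists>k r. p ^ k - r * u \<in> M" if u: "u \<notin> M" for u
  proof -
    \<comment> \<open>\<open>J\<close> is the ideal generated by \<open>M\<close> and
      \<open>u\<close>; by maximality it contains a power of \<open>p\<close>.\<close>
    define J where "J = {x. \<exists>r. x - r * u \<in> M}"
    have "is_ideal J"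
    proof (rule is_idealI)
      have "0 - 0 * u \<in> M" using is_ideal_0[OF idM] by simp
      then show "0 \<in> J" unfolding J_def by blast
    next
      fix a b assume "a \<in> J" "b \<in> J"
      then obtain r s where "a - r * u \<in> M" "b - s * u \<in> M" by (auto simp: J_def)
      from is_ideal_add[OF idM this] have "(a + b) - (r + s) * u \<in> M"
        by (simp add: algebra_simps)
      then show "a + b \<in> J" unfolding J_def by blast
    next
      fix t a assume "a \<in> J"
      then obtain r where "a - r * u \<in> M" by (auto simp: J_def)
      from is_ideal_mult[OF idM this, of t] have "t * a - (t * r) * u \<in> M"
        by (simp add: algebra_simps)
      then show "t * a \<in> J" unfolding J_def by blast
    qed
    moreover have "M \<subseteq> J"
    proof
      fix x assume "x \<in> M"
      then have "x - 0 * u \<in> M" by simp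
      then show "x \<in> J" unfolding J_def by blast
    qed
    moreover have "u \<in> J"
    proof -
      have "u - 1 * u \<in> M" using is_ideal_0[OF idM] by simp
      then show ?thesis unfolding J_def by blast
    qed
    ultimately have "J \<notin> \<A>" using max u by blast
    then have "\<exists>k. p ^ k \<in> J"
      using \<open>is_ideal J\<close> \<open>M \<subseteq> J\<close> M by (auto simp: \<A>_def)
    then show ?thesis by (auto simp: J_def)
  qed
  with M that show thesis by (auto simp: \<A>_def)
qed

section \<open>Residues modulo an ideal of complex polynomials\<close>

lemma countable_monoms: "countable (UNIV :: ('n::finite \<Rightarrow>\<^sub>0 nat) set)"
proof (rule countableI')
  show "inj (to_nat \<circ> (lookup :: ('n \<Rightarrow>\<^sub>0 nat) \<Rightarrow> 'n \<Rightarrow> nat))"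
    by (rule inj_compose[OF inj_to_nat]) (simp add: inj_on_def lookup_inject)
qed

lemma infinite_fibre:
  assumes "uncountable A" "countable B" "f ` A \<subseteq> B"
  obtains y where "infinite {x \<in> A. f x = y}"
proof -
  have "A = (\<Union>y\<in>B. {x \<in> A. f x = y})" using assms(3) by blast
  with assms(1,2) have "\<exists>y\<in>B. uncountable {x \<in> A. f x = y}"
    by (metis (no_types, lifting) countable_UN)
  then show thesis using that countable_finite by blast
qed

interpretation mpoly: vector_space "\<lambda>a q. single 0 a * q :: 'm::comm_monoid_add \<Rightarrow>\<^sub>0 'k::field"
  by unfold_locales (simp_all add: distrib_left distrib_right single_add mult_single flip: mult.assoc)

lemma keys_subset_in_span: "keys q \<subseteq> K \<Longrightarrow> q \<in> mpoly.span ((\<lambda>m. single m 1) ` K)"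
proof -
  assume K: "keys q \<subseteq> K"
  have "q = (\<Sum>m\<in>keys q. single 0 (lookup q m) * single m 1)"
    by (subst poly_mapping_eq_sum) (simp add: mult_single)
  also have "\<dots> \<in> mpoly.span ((\<lambda>m. single m 1) ` K)"
    using K by (intro mpoly.span_sum mpoly.span_scale mpoly.span_base) auto
  finally show ?thesis .
qed

text \<open>Infinitely many polynomials supported in \<open>K\<close> exceed the dimension of the
  span of these monomials. Injectivity turns a dependence between values of \<open>q\<close> into
  one between indices.\<close>

lemma linear_relation_of_infinite_family:
  fixes q :: "'b \<Rightarrow> ('m::comm_monoid_add \<Rightarrow>\<^sub>0 'k::field)"
  assumes inf: "infinite S" and inj: "inj_on q S" and K: "finite K" "\<And>a. a \<in> S \<Longrightarrow> keys (q a) \<subseteq> K"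
  obtains T c a0 where "finite T" "T \<subseteq> S" "(\<Sum>a\<in>T. single 0 (c a) * q a) = 0" "a0 \<in> T" "c a0 \<noteq> 0"
proof -
  have "mpoly.dependent (q ` S)"
  proof (rule ccontr)
    assume "\<not> mpoly.dependent (q ` S)"
    moreover have "q ` S \<subseteq> mpoly.span ((\<lambda>m. single m 1) ` K)"
      using K(2) keys_subset_in_span by blast
    ultimately have "finite (q ` S)"
      using mpoly.independent_span_bound[of "(\<lambda>m. single m 1) ` K" "q ` S"] K(1) by simp
    then show False using inf inj by (simp add: finite_image_iff)
  qed
  then obtain T' u v where T': "finite T'" "T' \<subseteq> q ` S" "(\<Sum>v\<in>T'. single 0 (u v) * v) = 0"
      "v \<in> T'" "u v \<noteq> 0"
    unfolding mpoly.dependent_explicit by blast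
  then obtain T where T: "T \<subseteq> S" "T' = q ` T" by (meson subset_imageE)
  then have injT: "inj_on q T" using inj inj_on_subset by blast
  with T'(1) T have "finite T" by (simp add: finite_image_iff)
  moreover have "(\<Sum>a\<in>T. single 0 (u (q a)) * q a) = 0"
    using T'(3) by (simp add: T sum.reindex[OF injT])
  moreover obtain a0 where "a0 \<in> T" "u (q a0) \<noteq> 0" using T T'(4,5) by auto
  ultimately show thesis using that[of T "\<lambda>a. u (q a)"] T(1) by blast
qed

text \<open>Over the complex numbers \<open>h\<close> splits, and primality puts one of the linear
  factors, taken at \<open>x\<close>, into \<open>M\<close>. The constant left over cannot lie in
  \<open>M\<close>, being a unit.\<close>

lemma poly_in_prime_has_linear_factor:
  fixes c :: "complex \<Rightarrow> 'a::comm_ring_1"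
  assumes M: "is_ideal M" "1 \<notin> M" "\<And>u v. u * v \<in> M \<Longrightarrow> u \<in> M \<or> v \<in> M"
    and c: "comm_ring_hom c" and h: "h \<noteq> 0" "poly (map_poly c h) x \<in> M"
  shows "\<exists>a. x - c a \<in> M"
  using h
proof (induction "degree h" arbitrary: h)
  case 0
  interpret c: comm_ring_hom c by (rule c)
  obtain b where b: "h = [:b:]" using 0 by (metis degree_eq_zeroE)
  with 0 have "c b \<in> M" "b \<noteq> 0" by (auto simp: c.map_poly_hom_pCons)
  then have "c (inverse b * b) \<in> M" by (simp only: c.hom_mult is_ideal_mult[OF M(1)])
  with \<open>b \<noteq> 0\<close> M(2) show ?case by (simp add: c.hom_one)
next
  case (Suc n)
  interpret c: comm_ring_hom c by (rule c)
  have "\<not> constant (poly h)" using Suc by (simp add: constant_degree)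
  then obtain a where "poly h a = 0" using fundamental_theorem_of_algebra by blast
  then obtain h' where h': "h = [:- a, 1:] * h'" by (auto simp: poly_eq_0_iff_dvd)
  with Suc have "h' \<noteq> 0" by auto
  then have "degree h = Suc (degree h')"
    unfolding h' using degree_mult_eq[of "[:- a, 1:]" h'] by simp
  with Suc have "degree h' = n" by simp
  have "poly (map_poly c h) x = (x - c a) * poly (map_poly c h') x"
    unfolding h' c.map_poly_hom_mult
    by (simp add: c.map_poly_hom_pCons c.hom_uminus c.hom_one algebra_simps)
  then have "x - c a \<in> M \<or> poly (map_poly c h') x \<in> M" using M(3) Suc by metis
  then show ?case using Suc \<open>h' \<noteq> 0\<close> \<open>degree h' = n\<close> by blast
qed

text \<open>
  If no \<open>x - a\<close> lies in \<open>M\<close>, then every \<open>x - a\<close> divides a power of \<open>p\<close> modulo \<open>M\<close>. There are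
  uncountably many \<open>a\<close>, but the polynomials have countable dimension, so the cofactors satisfy a
  linear relation. Clearing denominators makes \<open>x\<close> algebraic modulo \<open>M\<close>.
\<close>

lemma exists_residue:
  fixes x p :: "('n::finite \<Rightarrow>\<^sub>0 nat) \<Rightarrow>\<^sub>0 complex"
  assumes M: "is_ideal M" and p: "\<And>k. p ^ k \<notin> M"
    and max: "\<And>u. u \<notin> M \<Longrightarrow> \<exists>k r. p ^ k - r * u \<in> M"
  shows "\<exists>a. x - single 0 a \<in> M"
proof (rule ccontr)
  assume contr: "\<not> ?thesis"
  define c :: "complex \<Rightarrow> ('n \<Rightarrow>\<^sub>0 nat) \<Rightarrow>\<^sub>0 complex" where "c = single 0"
  have hom: "comm_ring_hom c"
    unfolding c_def by unfold_locales (simp_all add: single_add mult_single)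
  interpret c: comm_ring_hom c by (rule hom)
  have prime: "u \<in> M \<or> v \<in> M" if uv: "u * v \<in> M" for u v
  proof (rule ccontr)
    assume "\<not> (u \<in> M \<or> v \<in> M)"
    then obtain k r l s where *: "p ^ k - r * u \<in> M" "p ^ l - s * v \<in> M"
      using max by meson
    \<comment> \<open>Modulo \<open>M\<close> the powers \<open>p ^ k\<close> and
      \<open>p ^ l\<close> are multiples of \<open>u\<close> and of \<open>v\<close>, so
      \<open>p ^ (k + l)\<close> is a multiple of \<open>u * v\<close>.\<close>
    have "p ^ l * (p ^ k - r * u) + (r * u) * (p ^ l - s * v) + (r * s) * (u * v) \<in> M"
      by (intro is_ideal_add[OF M] is_ideal_mult[OF M] * uv)
    also have "p ^ l * (p ^ k - r * u) + (r * u) * (p ^ l - s * v) + (r * s) * (u * v) = p ^ (k + l)"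
      by (simp add: algebra_simps power_add)
    finally show False using p by blast
  qed
  have one: "1 \<notin> M" using p[of 0] by simp
  have "\<forall>a. \<exists>k q. p ^ k - q * (x - c a) \<in> M" using contr max by (simp add: c_def)
  then obtain k q where kq: "\<And>a. p ^ k a - q a * (x - c a) \<in> M" by metis
  \<comment> \<open>A linear relation needs a finite-dimensional space. There are only countably
    many pairs of an exponent \<open>k a\<close> and a support of \<open>q a\<close>, hence
    infinitely many \<open>a\<close> share one pair, and their cofactors use the same finitely many
    monomials.\<close>
  have "countable (UNIV \<times> {K :: ('n \<Rightarrow>\<^sub>0 nat) set. finite K} :: (nat \<times> _) set)"
    using countable_Collect_finite_subset[OF countable_monoms] by (intro countable_SIGMA) simp_all
  then obtain y where "infinite {a \<in> UNIV. (k a, keys (q a)) = y}"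
    by (rule infinite_fibre[where f = "\<lambda>a. (k a, keys (q a))", OF uncountable_UNIV_complex]) auto
  then obtain k0 K where inf: "infinite {a. k a = k0 \<and> keys (q a) = K}"
    by (cases y) auto
  define S where "S = {a. k a = k0 \<and> keys (q a) = K}"
  have "inj_on q S"
  proof
    fix a b assume ab: "a \<in> S" "b \<in> S" "q a = q b"
    show "a = b"
    proof (rule ccontr)
      assume ne: "a \<noteq> b"
      have 1: "p ^ k0 - q a * (x - c a) \<in> M" and 2: "p ^ k0 - q a * (x - c b) \<in> M"
        using kq[of a] kq[of b] ab by (auto simp: S_def)
      \<comment> \<open>Subtracting the congruences for \<open>a\<close> and \<open>b\<close>
        cancels \<open>p ^ k0\<close>. Since \<open>a - b\<close> is invertible, \<open>q a\<close>
        would lie in \<open>M\<close>, and with it \<open>p ^ k0\<close>.\<close>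
      have "q a * c (a - b) \<in> M"
        using is_ideal_minus[OF M 1 2] by (simp add: algebra_simps c.hom_minus)
      from is_ideal_mult[OF M this, of "c (inverse (a - b))"] have "q a \<in> M"
        using ne by (simp add: mult.left_commute c.hom_one flip: c.hom_mult)
      then have "q a * (x - c a) \<in> M" by (rule is_ideal_mult'[OF M])
      from is_ideal_add[OF M 1 this] show False using p by simp
    qed
  qed
  moreover have "infinite S" using inf by (simp add: S_def)
  moreover have "finite K" using inf by (metis (mono_tags, lifting) Collect_empty_eq finite.emptyI finite_keys)
  ultimately obtain T d a0 where T: "finite T" "T \<subseteq> S" "(\<Sum>a\<in>T. c (d a) * q a) = 0"
      "a0 \<in> T" "d a0 \<noteq> 0"
    unfolding c_def using linear_relation_of_infinite_family[of S q K] by (auto simp: S_def)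
  \<comment> \<open>The numerator of the sum of the partial fractions \<open>d a / (t - a)\<close>.
    At \<open>a0\<close> every other summand vanishes, so \<open>h\<close> is nonzero.\<close>
  define h where "h = (\<Sum>a\<in>T. [:d a:] * (\<Prod>b\<in>T - {a}. [:- b, 1:]))"
  have "poly h a0 = (\<Sum>a\<in>T. if a = a0 then d a0 * (\<Prod>b\<in>T - {a0}. a0 - b) else 0)"
    unfolding h_def poly_sum using T
    by (intro sum.cong refl) (auto simp: poly_prod algebra_simps)
  then have "h \<noteq> 0" using T by auto
  define P where "P = (\<Prod>b\<in>T. x - c b)"
  interpret ev: comm_ring_hom "\<lambda>p. poly (map_poly c p) x"
    by (rule c.comm_ring_hom_poly_map_poly)
  have h: "poly (map_poly c h) x = (\<Sum>a\<in>T. c (d a) * (\<Prod>b\<in>T - {a}. x - c b))"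
    by (simp add: h_def ev.hom_sum ev.hom_mult ev.hom_prod c.map_poly_hom_pCons c.hom_uminus c.hom_one
      del: mult_pCons_left)
  \<comment> \<open>In each summand \<open>p ^ k0\<close> may be replaced by
    \<open>q a * (x - c a)\<close> modulo \<open>M\<close>. The factor \<open>x - c a\<close>
    completes the product to \<open>P\<close>, and what remains is \<open>P\<close> times the
    vanishing linear relation.\<close>
  have "p ^ k0 * poly (map_poly c h) x
      = (\<Sum>a\<in>T. c (d a) * (\<Prod>b\<in>T - {a}. x - c b) * (p ^ k a - q a * (x - c a)))
        + (\<Sum>a\<in>T. c (d a) * q a) * P" (is "_ = ?r + _")
  proof -
    have "p ^ k0 * (c (d a) * (\<Prod>b\<in>T - {a}. x - c b))
        = c (d a) * (\<Prod>b\<in>T - {a}. x - c b) * (p ^ k a - q a * (x - c a)) + c (d a) * q a * P"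
      if "a \<in> T" for a
    proof -
      have P: "P = (x - c a) * (\<Prod>b\<in>T - {a}. x - c b)"
        unfolding P_def using T(1) that by (simp add: prod.remove)
      have "k a = k0" using T(2) that by (auto simp: S_def)
      then show ?thesis unfolding P by (simp add: algebra_simps)
    qed
    then show ?thesis
      unfolding h sum_distrib_left sum_distrib_right by (simp add: sum.distrib)
  qed
  also have "\<dots> = ?r" by (simp add: T(3))
  also have "?r \<in> M"
    by (intro is_ideal_sum[OF M] is_ideal_mult[OF M] kq)
  finally have "p ^ k0 * poly (map_poly c h) x \<in> M" .
  then have "poly (map_poly c h) x \<in> M" using prime p by blast
  then have "\<exists>a. x - c a \<in> M"
    using \<open>h \<noteq> 0\<close> prime one hom M by (intro poly_in_prime_has_linear_factor)
  then show False using contr by (simp add: c_def)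
qed

section \<open>Complexification of real polynomials\<close>

lemma lookup_map: "g 0 = 0 \<Longrightarrow> lookup (Poly_Mapping.map g p) m = g (lookup p m)"
  by transfer (simp add: when_def)

context
begin

private abbreviation "re \<equiv> Poly_Mapping.map Re"
private abbreviation "im \<equiv> Poly_Mapping.map Im"
private abbreviation "emb \<equiv> Poly_Mapping.map complex_of_real"

lemma poly_mapping_map_add:
  assumes "g 0 = 0" "\<And>a b. g (a + b) = g a + g b"
  shows "Poly_Mapping.map g (p + q) = Poly_Mapping.map g p + Poly_Mapping.map g q"
  by (rule poly_mapping_eqI) (simp add: lookup_map lookup_add assms)

text \<open>Together with \<open>im_mult\<close> this shows that the polynomials with real and
  imaginary parts in a real ideal form an ideal over the complex numbers.\<close>

lemma re_mult: "re (p * q) = re p * re q - im p * im q"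
  for p :: "'m::comm_monoid_add \<Rightarrow>\<^sub>0 complex"
proof (induction p rule: poly_mapping_add_induct)
  case (single m a)
  show ?case
    by (induction q rule: poly_mapping_add_induct)
      (simp_all add: mult_single single_diff distrib_left poly_mapping_map_add)
qed (simp add: distrib_right poly_mapping_map_add)

lemma im_mult: "im (p * q) = re p * im q + im p * re q"
  for p :: "'m::comm_monoid_add \<Rightarrow>\<^sub>0 complex"
proof (induction p rule: poly_mapping_add_induct)
  case (single m a)
  show ?case
    by (induction q rule: poly_mapping_add_induct)
      (simp_all add: mult_single distrib_left poly_mapping_map_add flip: single_add)
qed (simp add: distrib_right poly_mapping_map_add)

lemma emb_add: "emb (p + q) = emb p + emb q"
  by (simp add: poly_mapping_map_add)

lemma emb_mult: "emb (p * q) = emb p * emb q"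
  for p :: "'m::comm_monoid_add \<Rightarrow>\<^sub>0 real"
proof (induction p rule: poly_mapping_add_induct)
  case (single m a)
  show ?case
    by (induction q rule: poly_mapping_add_induct)
      (simp_all add: mult_single distrib_left emb_add)
qed (simp add: distrib_right emb_add)

lemma comm_ring_hom_emb:
  "comm_ring_hom (emb :: ('m::comm_monoid_add \<Rightarrow>\<^sub>0 real) \<Rightarrow> _)"
proof
  have "emb (single 0 1 :: 'm \<Rightarrow>\<^sub>0 real) = single 0 1"
    by (subst map_single) simp_all
  then show "emb (1 :: 'm \<Rightarrow>\<^sub>0 real) = 1" by simp
qed (fact emb_add emb_mult)+

text \<open>If no power of \<open>p\<close> lies in \<open>I\<close>, some ideal \<open>M\<close>
  above the complexified \<open>I\<close> is maximal among those avoiding the powers. Modulo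
  \<open>M\<close> each variable is a constant, and these constants form a point where the members
  of \<open>I\<close> vanish but \<open>p\<close> does not.\<close>

theorem real_nullstellensatz_complex_zeros:
  fixes I :: "'n::finite rpoly set"
  assumes I: "is_ideal I" and p: "\<And>z. z \<in> V_complex I \<Longrightarrow> eval_complex p z = 0"
  shows "p \<in> radical I"
proof (rule ccontr)
  assume np: "p \<notin> radical I"
  interpret emb: comm_ring_hom "emb :: 'n rpoly \<Rightarrow> _" by (rule comm_ring_hom_emb)
  \<comment> \<open>The extension I + iI of \<open>I\<close> to complex coefficients; given by
    parts, it meets the real polynomials exactly in \<open>I\<close>.\<close>
  define J where "J = {q. re q \<in> I \<and> im q \<in> I}"
  have re_emb: "re (emb q) = q" "im (emb q) = 0" for q :: "'n rpoly"
    by (rule poly_mapping_eqI; simp add: lookup_map)+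
  have zero: "re 0 = (0 :: 'n rpoly)" "im 0 = (0 :: 'n rpoly)" by (simp_all add: map_eq_zero_iff)
  have J: "is_ideal J"
    unfolding J_def
    by (rule is_idealI)
      (auto simp: zero re_mult im_mult poly_mapping_map_add
        intro: is_ideal_0[OF I] is_ideal_add[OF I] is_ideal_minus[OF I] is_ideal_mult[OF I])
  have "p ^ k \<notin> I" for k
  proof (cases "k = 0")
    case True
    have "p \<in> I" if "1 \<in> I" using is_ideal_mult[OF I that, of p] by simp
    with np True subset_radical[of I] show ?thesis by auto
  next
    case False
    with np show ?thesis unfolding radical_def by blast
  qed
  then have "emb p ^ k \<notin> J" for k
    by (simp add: J_def re_emb flip: emb.hom_power)
  then obtain M where M: "is_ideal M" "J \<subseteq> M" "\<And>k. emb p ^ k \<notin> M"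
      "\<And>u. u \<notin> M \<Longrightarrow> \<exists>k r. emb p ^ k - r * u \<in> M"
    using exists_maximal_avoiding_powers[OF J] by metis
  have "\<forall>i. \<exists>a. emb (Var i) - single 0 a \<in> M"
    using exists_residue[OF M(1,3,4)] by blast
  then obtain a where a: "\<And>i. emb (Var i) - single 0 (a i) \<in> M" by metis
  define z where "z = (\<chi> i. a i)"
  \<comment> \<open>The residues of the variables determine all others: modulo \<open>M\<close> a
    real polynomial is its value at \<open>z\<close>.\<close>
  have res: "emb q - single 0 (eval_complex q z) \<in> M" for q
  proof (induction q rule: mpoly_induct)
    case (Const b)
    show ?case
      unfolding eval_complex_simps using is_ideal_0[OF M(1)] by (simp add: Const_def)
  next
    case (Var i)
    then show ?case using a unfolding eval_complex_simps by (simp add: z_def)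
  next
    case (add q r)
    from is_ideal_add[OF M(1) this] show ?case
      by (simp add: emb_add eval_complex_simps single_add algebra_simps)
  next
    case (mult q r)
    let ?q = "eval_complex q z" and ?r = "eval_complex r z"
    have "emb r * (emb q - single 0 ?q) + single 0 ?q * (emb r - single 0 ?r) \<in> M"
      by (intro is_ideal_add[OF M(1)] is_ideal_mult[OF M(1)] mult)
    also have "emb r * (emb q - single 0 ?q) + single 0 ?q * (emb r - single 0 ?r)
        = emb (q * r) - single 0 (eval_complex (q * r) z)"
      by (simp add: emb_mult eval_complex_simps algebra_simps mult_single)
    finally show ?case .
  qed
  have "z \<in> V_complex I"
    unfolding V_complex_def
  proof (rule CollectI, rule ballI)
    fix q assume "q \<in> I"
    then have "emb q \<in> M" using M(2) is_ideal_0[OF I] by (auto simp: J_def re_emb)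
    with res[of q] have *: "single 0 (eval_complex q z) \<in> M" using is_ideal_cong[OF M(1)] by blast
    show "eval_complex q z = 0"
    proof (rule ccontr)
      assume "eval_complex q z \<noteq> 0"
      then have "single 0 (inverse (eval_complex q z)) * single 0 (eval_complex q z) = (1 :: 'n monom \<Rightarrow>\<^sub>0 complex)"
        by (simp add: mult_single)
      with is_ideal_mult[OF M(1) *] have "1 \<in> M" by metis
      with M(3)[of 0] show False by simp
    qed
  qed
  with p res[of p] have "emb p ^ 1 \<in> M" by simp
  with M(3) show False by blast
qed

end

section \<open>Existence and uniqueness of reduced Groebner bases\<close>

lemma incseq_subseq_nat:
  fixes s :: "nat \<Rightarrow> nat"
  obtains r where "strict_mono r" "incseq (s \<circ> r)"
proof -
  obtain r where r: "strict_mono r" "monoseq (\<lambda>n. s (r n))" using seq_monosub by blast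
  show thesis
  proof (cases "incseq (s \<circ> r)")
    case False
    with r(2) have dec: "decseq (\<lambda>n. s (r n))"
      by (auto simp: monoseq_iff comp_def)
    \<comment> \<open>A decreasing sequence of naturals attains its minimum and is constant from
      there on, hence weakly increasing.\<close>
    define m where "m = (LEAST x. x \<in> range (\<lambda>n. s (r n)))"
    have "m \<in> range (\<lambda>n. s (r n))" unfolding m_def by (rule LeastI) blast
    then obtain N where N: "m = s (r N)" by blast
    have "s (r (n + N)) = m" for n
    proof (rule antisym)
      show "s (r (n + N)) \<le> m" unfolding N using dec by (auto simp: decseq_def)
      show "m \<le> s (r (n + N))" unfolding m_def by (rule Least_le) blast
    qed
    then have "incseq (s \<circ> (r \<circ> (\<lambda>n. n + N)))" by (simp add: comp_def)
    moreover have "strict_mono (r \<circ> (\<lambda>n. n + N))"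
      using r(1) by (intro strict_mono_o) (simp_all add: strict_mono_def)
    ultimately show ?thesis using that by blast
  qed (use r that in blast)
qed

text \<open>One coordinate after another is made monotone by passing to a subsequence. After
  finitely many passes all coordinates increase, and any two members compare.\<close>

lemma dickson:
  fixes s :: "nat \<Rightarrow> 'n::finite \<Rightarrow> nat"
  obtains i j where "i < j" "\<And>k. s i k \<le> s j k"
proof -
  have "\<exists>r. strict_mono r \<and> (\<forall>k\<in>S. incseq (\<lambda>n. s (r n) k))" if "finite S" for S
    using that
  proof induction
    case empty
    show ?case using strict_mono_id by auto
  next
    case (insert x S)
    then obtain r where r: "strict_mono r" "\<forall>k\<in>S. incseq (\<lambda>n. s (r n) k)" by blast
    obtain r' where r': "strict_mono r'" "incseq ((\<lambda>n. s (r n) x) \<circ> r')"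
      by (rule incseq_subseq_nat)
    have "mono r'" using r'(1) strict_mono_mono by blast
    then have "incseq (\<lambda>n. s ((r \<circ> r') n) k)" if "k \<in> insert x S" for k
      using that r(2) r'(2) by (auto simp: mono_def comp_def)
    moreover have "strict_mono (r \<circ> r')" using r r' by (intro strict_mono_o)
    ultimately show ?case by blast
  qed
  from this[of UNIV] obtain r where r: "strict_mono r" "\<forall>k. incseq (\<lambda>n. s (r n) k)" by auto
  have "s (r 0) k \<le> s (r 1) k" for k using r(2) by (simp add: mono_def)
  moreover have "r 0 < r 1" using r(1) by (simp add: strict_mono_def)
  ultimately show thesis using that by blast
qed

section \<open>Divisibility and the lexicographic order on monomials\<close>

definition monom_dvd :: "'n monom \<Rightarrow> 'n monom \<Rightarrow> bool" where
  "monom_dvd s t \<longleftrightarrow> (\<forall>i. lookup s i \<le> lookup t i)"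

lemma monom_dvd_refl: "monom_dvd s s"
  by (simp add: monom_dvd_def)

lemma monom_dvd_trans: "monom_dvd s t \<Longrightarrow> monom_dvd t u \<Longrightarrow> monom_dvd s u"
  unfolding monom_dvd_def using le_trans by blast

lemma monom_dvd_antisym: "monom_dvd s t \<Longrightarrow> monom_dvd t s \<Longrightarrow> s = t"
  by (rule poly_mapping_eqI) (simp add: monom_dvd_def antisym)

lemma monom_dvd_add: "monom_dvd s (u + s)"
  by (simp add: monom_dvd_def lookup_add)

lemma monom_dvd_diff: "monom_dvd s t \<Longrightarrow> (t - s) + s = t"
  by (rule poly_mapping_eqI) (simp add: monom_dvd_def lookup_add lookup_minus)

lemma lex_irrefl: "\<not> lex_less s s"
  by (simp add: lex_less_def)

lemma lex_trans:
  assumes "lex_less s t" "lex_less t u"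
  shows "lex_less s u"
proof -
  obtain i j where i: "lookup s i < lookup t i" "\<forall>k>i. lookup s k = lookup t k"
    and j: "lookup t j < lookup u j" "\<forall>k>j. lookup t k = lookup u k"
    using assms by (auto simp: lex_less_def)
  have "lookup s (max i j) < lookup u (max i j)"
    using i j by (cases i j rule: linorder_cases) (auto simp: max_def)
  moreover have "\<forall>k>max i j. lookup s k = lookup u k" using i j by simp
  ultimately show ?thesis unfolding lex_less_def by blast
qed

lemma lex_asym: "lex_less s t \<Longrightarrow> \<not> lex_less t s"
  using lex_trans lex_irrefl by blast

lemma lex_linear: "s = t \<or> lex_less s t \<or> lex_less t s"
  for s :: "'n::{finite,linorder} monom"
proof (cases "s = t")
  case False
  define D where "D = {i. lookup s i \<noteq> lookup t i}"
  have "D \<noteq> {}" using False by (auto simp: D_def intro: poly_mapping_eqI)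
  then have "Max D \<in> D" by (intro Max_in) simp_all
  moreover have "lookup s k = lookup t k" if "k > Max D" for k
  proof -
    have "finite D" by simp
    then have "k \<notin> D" using that Max_ge[of D k] by (metis leD)
    then show ?thesis by (simp add: D_def)
  qed
  ultimately show ?thesis unfolding lex_less_def D_def by (metis (mono_tags, lifting) mem_Collect_eq nat_neq_iff)
qed simp

lemma lex_add: "lex_less s t \<Longrightarrow> lex_less (u + s) (u + t)"
  by (simp add: lex_less_def lookup_add)

lemma monom_dvd_imp_lex: "monom_dvd s t \<Longrightarrow> s \<noteq> t \<Longrightarrow> lex_less s t"
  for s :: "'n::{finite,linorder} monom"
  using lex_linear[of s t] by (auto simp: lex_less_def monom_dvd_def dest: leD)

lemma monom_dvd_lex_trans: "monom_dvd s t \<Longrightarrow> lex_less t u \<Longrightarrow> lex_less s u"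
  for s :: "'n::{finite,linorder} monom"
  using monom_dvd_imp_lex lex_trans by blast

text \<open>By Dickson's lemma an infinite descent would contain an earlier monomial dividing a
  later one, yet a divisor never exceeds its multiples lexicographically.\<close>

lemma wf_lex_less: "wf {(s, t :: 'n::{finite,linorder} monom). lex_less s t}"
  unfolding wf_iff_no_infinite_down_chain
proof
  assume "\<exists>s. \<forall>i. (s (Suc i), s i) \<in> {(s, t :: 'n monom). lex_less s t}"
  then obtain s :: "nat \<Rightarrow> 'n monom" where s: "\<And>i. lex_less (s (Suc i)) (s i)" by auto
  have dec: "lex_less (s j) (s i)" if "i < j" for i j
    using that by (induction rule: strict_inc_induct) (use s lex_trans in blast)+
  obtain i j where ij: "i < j" "\<And>k. lookup (s i) k \<le> lookup (s j) k"
    using dickson[of "\<lambda>n. lookup (s n)"] by blast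
  then have "monom_dvd (s i) (s j)" by (simp add: monom_dvd_def)
  with dec[OF ij(1)] show False using monom_dvd_lex_trans lex_irrefl by blast
qed

lemmas lex_induct = wf_induct_rule[OF wf_lex_less, simplified, case_names less]

text \<open>Distinct minimal monomials never divide each other, and Dickson's lemma forbids
  infinitely many such. This makes the reduced basis finite.\<close>

lemma finite_minimal_monoms:
  "finite {m \<in> S. \<forall>m'\<in>S. monom_dvd m' m \<longrightarrow> m' = m}" (is "finite ?M")
  for S :: "'n::finite monom set"
proof (rule ccontr)
  assume "infinite ?M"
  then obtain s :: "nat \<Rightarrow> 'n monom" where s: "inj s" "range s \<subseteq> ?M"
    using infinite_countable_subset by blast
  obtain i j where ij: "i < j" "\<And>k. lookup (s i) k \<le> lookup (s j) k"
    using dickson[of "\<lambda>n. lookup (s n)"] by blast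
  then have "monom_dvd (s i) (s j)" by (simp add: monom_dvd_def)
  with s(2) have "s i = s j" by blast
  with s(1) ij(1) show False by (simp add: inj_eq)
qed

lemma exists_minimal_monom:
  fixes S :: "'n::{finite,linorder} monom set"
  assumes "m \<in> S"
  shows "\<exists>m'\<in>S. monom_dvd m' m \<and> (\<forall>m''\<in>S. monom_dvd m'' m' \<longrightarrow> m'' = m')"
  using assms
proof (induction m rule: lex_induct)
  case (less m)
  show ?case
  proof (cases "\<forall>m''\<in>S. monom_dvd m'' m \<longrightarrow> m'' = m")
    case True
    with less.prems show ?thesis using monom_dvd_refl by blast
  next
    case False
    then obtain n where "n \<in> S" "monom_dvd n m" "n \<noteq> m" by blast
    with less.IH[of n] show ?thesis using monom_dvd_trans monom_dvd_imp_lex by metis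
  qed
qed

section \<open>Leading monomials and reduction\<close>

lemma lead_monomial_eqI:
  assumes "m \<in> keys p" "\<And>m'. m' \<in> keys p \<Longrightarrow> m' \<noteq> m \<Longrightarrow> lex_less m' m"
  shows "lead_monomial p = m"
  unfolding lead_monomial_def
proof (rule the_equality)
  fix m' assume "m' \<in> keys p \<and> (\<forall>k\<in>keys p. k \<noteq> m' \<longrightarrow> lex_less k m')"
  then show "m' = m" using assms lex_asym by metis
qed (use assms in simp)

lemma lead_monomial_greatest:
  fixes p :: "'n::{finite,linorder} rpoly"
  assumes "p \<noteq> 0"
  shows lead_monomial_in_keys: "lead_monomial p \<in> keys p"
    and lex_less_lead_monomial: "m \<in> keys p \<Longrightarrow> m \<noteq> lead_monomial p \<Longrightarrow> lex_less m (lead_monomial p)"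
proof -
  have "keys p \<noteq> {}"
    using assms by (metis all_not_in_conv in_keys_iff lookup_zero poly_mapping_eqI)
  have "\<exists>m\<in>S. \<forall>m'\<in>S. m' \<noteq> m \<longrightarrow> lex_less m' m" if "finite S" "S \<noteq> {}" for S :: "'n monom set"
    using that
  proof (induction rule: finite_ne_induct)
    case (insert x S)
    then obtain m where m: "m \<in> S" "\<forall>m'\<in>S. m' \<noteq> m \<longrightarrow> lex_less m' m" by blast
    show ?case
    proof (cases "lex_less m x")
      case True
      with m have "\<forall>m'\<in>insert x S. m' \<noteq> x \<longrightarrow> lex_less m' x"
        by (metis insertE lex_trans)
      then show ?thesis by blast
    next
      case False
      with m insert.hyps have "\<forall>m'\<in>insert x S. m' \<noteq> m \<longrightarrow> lex_less m' m"
        by (metis insertE lex_linear)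
      with m show ?thesis by blast
    qed
  qed simp
  from this[OF _ \<open>keys p \<noteq> {}\<close>] obtain m where
    m: "m \<in> keys p" "\<forall>m'\<in>keys p. m' \<noteq> m \<longrightarrow> lex_less m' m" by auto
  then have "lead_monomial p = m" by (intro lead_monomial_eqI) auto
  with m show "lead_monomial p \<in> keys p"
    "m \<in> keys p \<Longrightarrow> m \<noteq> lead_monomial p \<Longrightarrow> lex_less m (lead_monomial p)" for m by auto
qed

lemma lead_coefficient_nonzero: "p \<noteq> 0 \<Longrightarrow> lead_coefficient p \<noteq> 0"
  for p :: "'n::{finite,linorder} rpoly"
  using lead_monomial_in_keys[of p] by (simp add: lead_coefficient_def in_keys_iff)

lemma lookup_single_mult: "lookup (single u c * p) (u + m) = c * lookup p m"
  for p :: "'n rpoly"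
proof (induction p rule: poly_mapping_add_induct)
  case (single n b)
  show ?case by (simp add: mult_single lookup_single when_def)
qed (simp add: distrib_left lookup_add)

lemma keys_single_mult: "keys (single u c * p) \<subseteq> (+) u ` keys p"
  for p :: "'n rpoly"
  using keys_mult[of "single u c" p] by (auto split: if_splits)

lemma keys_minus: "keys (p - q) \<subseteq> keys p \<union> keys q"
  for p :: "'a \<Rightarrow>\<^sub>0 'b::ab_group_add"
  by (auto simp: in_keys_iff lookup_minus)

lemma lead_monomial_single_mult:
  fixes p :: "'n::{finite,linorder} rpoly"
  assumes "p \<noteq> 0" "c \<noteq> 0"
  shows "lead_monomial (single u c * p) = u + lead_monomial p"
    and "single u c * p \<noteq> 0"
proof -
  have *: "u + lead_monomial p \<in> keys (single u c * p)"
    using assms lead_monomial_in_keys[of p] by (simp add: in_keys_iff lookup_single_mult)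
  then show "single u c * p \<noteq> 0" by auto
  show "lead_monomial (single u c * p) = u + lead_monomial p"
    using * keys_single_mult[of u c p] lex_less_lead_monomial[OF assms(1)] lex_add
    by (intro lead_monomial_eqI) blast+
qed

text \<open>Shift and factor are chosen so that the leading terms cancel; all other monomials of
  both polynomials are smaller already. The resulting bound is what drives the inductions
  below.\<close>

lemma reduction_step:
  fixes p g :: "'n::{finite,linorder} rpoly"
  assumes "p \<noteq> 0" "g \<noteq> 0" "monom_dvd (lead_monomial g) (lead_monomial p)"
  obtains u c where "\<And>k. k \<in> keys (p - single u c * g) \<Longrightarrow> lex_less k (lead_monomial p)"
proof
  define u where "u = lead_monomial p - lead_monomial g"
  define c where "c = lead_coefficient p / lead_coefficient g"
  have u: "u + lead_monomial g = lead_monomial p"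
    unfolding u_def by (rule monom_dvd_diff) (rule assms)
  have "c \<noteq> 0"
    unfolding c_def using assms by (metis divide_eq_0_iff lead_coefficient_nonzero)
  note g = lead_monomial_single_mult[OF assms(2) this, of u, unfolded u]
  fix k assume k: "k \<in> keys (p - single u c * g)"
  have "lookup (p - single u c * g) (lead_monomial p) = 0"
    using assms lead_coefficient_nonzero[of g]
    by (simp add: lookup_minus lookup_single_mult flip: u)
      (simp add: u c_def flip: lead_coefficient_def)
  with k have "k \<noteq> lead_monomial p" by auto
  moreover have "k \<in> keys p \<or> k \<in> keys (single u c * g)" using k keys_minus[of p "single u c * g"] by blast
  ultimately show "lex_less k (lead_monomial p)"
    using lex_less_lead_monomial[OF assms(1), of k] lex_less_lead_monomial[OF g(2), of k]
    unfolding g(1) by blast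
qed

section \<open>Initial ideals as monomial ideals\<close>

definition lead_monomials :: "'n::linorder rpoly set \<Rightarrow> 'n monom set" where
  "lead_monomials S = lead_monomial ` (S - {0})"

lemma lead_monomialsE:
  assumes "m \<in> lead_monomials S"
  obtains p where "p \<in> S" "p \<noteq> 0" "lead_monomial p = m"
  using assms by (auto simp: lead_monomials_def)

text \<open>In an ideal generated by terms, every monomial of every member is a multiple of a
  generating one. This statement about all monomials is the one that survives induction over the
  ideal.\<close>

lemma monomial_in_lead_ideal_iff:
  fixes S :: "'n::{finite,linorder} rpoly set"
  shows "single m 1 \<in> lead_ideal S \<longleftrightarrow> (\<exists>m'\<in>lead_monomials S. monom_dvd m' m)"
proof
  have "\<forall>k\<in>keys q. \<exists>m'\<in>lead_monomials S. monom_dvd m' k" if "q \<in> lead_ideal S" for q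
    using that unfolding lead_ideal_def
  proof (induction rule: ideal_induct)
    case (base b)
    then show ?case
      by (auto simp: lead_term_def lead_monomials_def intro!: bexI monom_dvd_refl split: if_splits)
  next
    case (add p q)
    then show ?case using keys_add[of p q] by blast
  next
    case (mult r p)
    show ?case
    proof
      fix k assume "k \<in> keys (r * p)"
      then obtain a b where "k = a + b" "b \<in> keys p" using keys_mult[of r p] by blast
      with mult show "\<exists>m'\<in>lead_monomials S. monom_dvd m' k"
        using monom_dvd_add monom_dvd_trans by blast
    qed
  qed simp
  then show "single m 1 \<in> lead_ideal S \<Longrightarrow> \<exists>m'\<in>lead_monomials S. monom_dvd m' m"
    by force
next
  assume "\<exists>m'\<in>lead_monomials S. monom_dvd m' m"
  then obtain p where p: "p \<in> S - {0}" "monom_dvd (lead_monomial p) m"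
    by (auto simp: lead_monomials_def)
  then have "lead_coefficient p \<noteq> 0" by (simp add: lead_coefficient_nonzero)
  then have "single m 1 = single (m - lead_monomial p) (1 / lead_coefficient p) * lead_term p"
    using p(2) by (simp add: lead_term_def mult_single monom_dvd_diff)
  also have "\<dots> \<in> lead_ideal S"
    unfolding lead_ideal_def using p(1) by (intro ideal_mult ideal_base) blast
  finally show "single m 1 \<in> lead_ideal S" .
qed

text \<open>Turns the comparison of initial ideals into a covering condition on exponent vectors,
  the form in which Groebner bases are used and checked below.\<close>

lemma lead_ideal_eq_iff:
  fixes G :: "'n::{finite,linorder} rpoly set"
  assumes "G \<subseteq> I"
  shows "lead_ideal G = lead_ideal I \<longleftrightarrow>
    (\<forall>m\<in>lead_monomials I. \<exists>m'\<in>lead_monomials G. monom_dvd m' m)"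
proof
  assume eq: "lead_ideal G = lead_ideal I"
  show "\<forall>m\<in>lead_monomials I. \<exists>m'\<in>lead_monomials G. monom_dvd m' m"
  proof
    fix m assume "m \<in> lead_monomials I"
    then have "single m 1 \<in> lead_ideal G"
      unfolding eq monomial_in_lead_ideal_iff using monom_dvd_refl by blast
    then show "\<exists>m'\<in>lead_monomials G. monom_dvd m' m"
      unfolding monomial_in_lead_ideal_iff .
  qed
next
  assume *: "\<forall>m\<in>lead_monomials I. \<exists>m'\<in>lead_monomials G. monom_dvd m' m"
  show "lead_ideal G = lead_ideal I"
  proof
    have "lead_term ` (G - {0}) \<subseteq> lead_ideal I"
      unfolding lead_ideal_def using assms by (auto intro!: ideal_base)
    then show "lead_ideal G \<subseteq> lead_ideal I"
      unfolding lead_ideal_def by (rule ideal_subset[OF is_ideal_ideal])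
    have "lead_term p \<in> lead_ideal G" if "p \<in> I - {0}" for p
    proof -
      have "lead_monomial p \<in> lead_monomials I" using that by (simp add: lead_monomials_def)
      with * have "single (lead_monomial p) 1 \<in> lead_ideal G"
        by (simp add: monomial_in_lead_ideal_iff)
      then have "single 0 (lead_coefficient p) * single (lead_monomial p) 1 \<in> lead_ideal G"
        unfolding lead_ideal_def by (rule ideal_mult)
      then show ?thesis by (simp add: lead_term_def mult_single)
    qed
    then have "lead_term ` (I - {0}) \<subseteq> lead_ideal G" by blast
    then show "lead_ideal I \<subseteq> lead_ideal G"
      unfolding lead_ideal_def by (rule ideal_subset[OF is_ideal_ideal])
  qed
qed

section \<open>Normal forms and the reduced Groebner basis of an ideal\<close>

context
  fixes I :: "'n::{finite,linorder} rpoly set"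
  assumes I: "is_ideal I"
begin

lemma lead_monomials_dvd_closed:
  assumes "m \<in> lead_monomials I" "monom_dvd m m'"
  shows "m' \<in> lead_monomials I"
proof -
  obtain p where p: "p \<in> I" "p \<noteq> 0" "m = lead_monomial p"
    using assms(1) by (auto simp: lead_monomials_def)
  let ?q = "single (m' - m) 1 * p"
  have "lead_monomial ?q = m'" "?q \<noteq> 0" "?q \<in> I"
    using lead_monomial_single_mult[OF p(2), of 1] monom_dvd_diff[OF assms(2)] p
      is_ideal_mult[OF I] by auto
  then show ?thesis unfolding lead_monomials_def by (metis DiffI image_eqI singletonD)
qed

text \<open>Division by \<open>G\<close>: the leading monomial of a nonzero member of
  \<open>I\<close> is a multiple of one from \<open>G\<close> and can be cancelled without leaving
  \<open>I\<close>. Well-foundedness ends the process, necessarily at 0.\<close>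

lemma ideal_groebner_basis:
  assumes G: "groebner_basis I G"
  shows "ideal G = I"
proof
  have sub: "G \<subseteq> I" using G by (simp add: groebner_basis_def)
  then show "ideal G \<subseteq> I" by (rule ideal_subset[OF I])
  have cover: "\<forall>m\<in>lead_monomials I. \<exists>m'\<in>lead_monomials G. monom_dvd m' m"
    using G lead_ideal_eq_iff[OF sub] by (simp add: groebner_basis_def)
  \<comment> \<open>The induction runs over a strict upper bound \<open>m\<close> of the monomials,
    because \<open>lead_monomial p\<close> is unspecified for \<open>p = 0\<close>.\<close>
  have "p \<in> ideal G" if "p \<in> I" "\<And>k. k \<in> keys p \<Longrightarrow> lex_less k m" for m p
    using that
  proof (induction m arbitrary: p rule: lex_induct)
    case (less m)
    show ?case
    proof (cases "p = 0")
      case False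
      with less.prems have "lead_monomial p \<in> lead_monomials I" by (simp add: lead_monomials_def)
      with cover obtain g where g: "g \<in> G" "g \<noteq> 0" "monom_dvd (lead_monomial g) (lead_monomial p)"
        by (metis lead_monomialsE)
      obtain u c where *: "\<And>k. k \<in> keys (p - single u c * g) \<Longrightarrow> lex_less k (lead_monomial p)"
        using reduction_step[OF False g(2,3)] by blast
      have "p - single u c * g \<in> I"
        using less.prems g sub by (intro is_ideal_minus[OF I] is_ideal_mult[OF I]) auto
      then have "p - single u c * g \<in> ideal G"
        using * less.prems lead_monomial_in_keys[OF False] by (intro less.IH)
      from ideal_add[OF this ideal_mult[OF ideal_base[OF g(1)], of "single u c"]]
      show ?thesis by simp
    qed (simp add: ideal_0)
  qed
  moreover have "\<exists>m. \<forall>k\<in>keys p. lex_less k m" for p :: "'n rpoly"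
  proof (cases "p = 0")
    case False
    \<comment> \<open>Multiplying the leading monomial by a variable yields a strict upper
      bound.\<close>
    have "lex_less m (single first_var 1 + m)" for m :: "'n monom"
      by (rule monom_dvd_imp_lex[OF monom_dvd_add])
        (metis add_cancel_left_left lookup_single_eq lookup_zero one_neq_zero)
    with False show ?thesis by (metis lex_less_lead_monomial lex_trans)
  qed simp
  ultimately show "I \<subseteq> ideal G" by blast
qed

text \<open>Division by all of \<open>I\<close> at once: a leading term is cancelled if its monomial
  is leading in \<open>I\<close>, and moved to the remainder otherwise. The bound is carried along
  so that a term at \<open>m\<close> added to \<open>r\<close> is leading.\<close>

lemma exists_normal_form:
  fixes p :: "'n rpoly"
  assumes "\<And>k. k \<in> keys p \<Longrightarrow> lex_less k m"
  shows "\<exists>r. p - r \<in> I \<and> (\<forall>k\<in>keys r. lex_less k m \<and> k \<notin> lead_monomials I)"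
  using assms
proof (induction m arbitrary: p rule: lex_induct)
  case (less m)
  show ?case
  proof (cases "p = 0")
    case True
    then show ?thesis using is_ideal_0[OF I] by (intro exI[of _ 0]) simp
  next
    case False
    have lm: "lex_less (lead_monomial p) m" using less.prems lead_monomial_in_keys[OF False] .
    show ?thesis
    proof (cases "lead_monomial p \<in> lead_monomials I")
      case True
      then obtain g where g: "g \<in> I" "g \<noteq> 0" "lead_monomial g = lead_monomial p"
        by (rule lead_monomialsE)
      obtain u c where "\<And>k. k \<in> keys (p - single u c * g) \<Longrightarrow> lex_less k (lead_monomial p)"
        using reduction_step[OF False g(2)] g(3) monom_dvd_refl by metis
      with less.IH[OF lm] obtain r where r: "p - single u c * g - r \<in> I"
        "\<forall>k\<in>keys r. lex_less k (lead_monomial p) \<and> k \<notin> lead_monomials I" by blast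
      have "(p - single u c * g - r) + single u c * g \<in> I"
        by (intro is_ideal_add[OF I] r is_ideal_mult[OF I] g)
      then have "p - r \<in> I" by (simp add: algebra_simps)
      with r lm lex_trans show ?thesis by blast
    next
      case notin: False
      let ?t = "single (lead_monomial p) (lead_coefficient p) :: 'n rpoly"
      have "lex_less k (lead_monomial p)" if "k \<in> keys (p - ?t)" for k
      proof -
        have "k \<noteq> lead_monomial p"
          using that by (auto simp: in_keys_iff lookup_minus lead_coefficient_def)
        with that have "k \<in> keys p" by (simp add: in_keys_iff lookup_minus lookup_single_not_eq)
        with \<open>k \<noteq> lead_monomial p\<close> show ?thesis by (intro lex_less_lead_monomial False)
      qed
      with less.IH[OF lm] obtain r where r: "p - ?t - r \<in> I"
        "\<forall>k\<in>keys r. lex_less k (lead_monomial p) \<and> k \<notin> lead_monomials I" by blast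
      have "p - (?t + r) \<in> I" using r(1) by (simp add: algebra_simps)
      moreover have "\<forall>k\<in>keys (?t + r). lex_less k m \<and> k \<notin> lead_monomials I"
      proof
        fix k assume "k \<in> keys (?t + r)"
        then have "k = lead_monomial p \<or> k \<in> keys r"
          using keys_add[of ?t r] by (auto split: if_splits)
        then show "lex_less k m \<and> k \<notin> lead_monomials I"
          using r(2) lm notin lex_trans[of k "lead_monomial p" m] by auto
      qed
      ultimately show ?thesis by blast
    qed
  qed
qed

text \<open>Membership refers to \<open>I\<close> alone and not to the other elements of a basis.
  Every reduced Groebner basis can be compared with this one set, which settles existence and
  uniqueness together.\<close>

definition reduced_elements :: "'n rpoly set" where
  "reduced_elements = {p \<in> I. lead_coefficient p = 1 \<and>
     (\<forall>k\<in>keys p. k \<noteq> lead_monomial p \<longrightarrow> k \<notin> lead_monomials I) \<and>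
     (\<forall>m\<in>lead_monomials I. monom_dvd m (lead_monomial p) \<longrightarrow> m = lead_monomial p)}"

lemma nonzero_if_monic: "lead_coefficient p = 1 \<Longrightarrow> p \<noteq> 0" for p :: "'n rpoly"
  by (auto simp: lead_coefficient_def)

text \<open>In the difference the leading terms cancel and only tail monomials remain, none of them
  leading in \<open>I\<close>. As the difference lies in \<open>I\<close>, it is 0.\<close>

lemma reduced_elements_lead_monomial_inj: "inj_on lead_monomial reduced_elements"
proof
  fix p q assume p: "p \<in> reduced_elements" and q: "q \<in> reduced_elements"
    and eq: "lead_monomial p = lead_monomial q"
  show "p = q"
  proof (rule ccontr)
    assume "p \<noteq> q"
    then have ne: "p - q \<noteq> 0" by simp
    let ?m = "lead_monomial (p - q)"
    have m: "?m \<in> keys (p - q)" by (rule lead_monomial_in_keys[OF ne])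
    have "lookup (p - q) (lead_monomial p) = 0"
      using p q eq by (simp add: lookup_minus reduced_elements_def lead_coefficient_def)
    with m have "?m \<noteq> lead_monomial p" by auto
    moreover have "?m \<in> keys p \<union> keys q" using m keys_minus[of p q] by blast
    ultimately have "?m \<notin> lead_monomials I"
      using p q eq by (auto simp: reduced_elements_def)
    moreover have "p - q \<in> I"
      using p q is_ideal_minus[OF I] by (auto simp: reduced_elements_def)
    ultimately show False using ne by (auto simp: lead_monomials_def)
  qed
qed

text \<open>A monic member of \<open>I\<close> keeps its leading monomial when its tail is replaced
  by the normal form of the tail, and the change lies in \<open>I\<close>.\<close>

lemma exists_reduced_element:
  assumes m: "m \<in> lead_monomials I" and min: "\<And>m'. m' \<in> lead_monomials I \<Longrightarrow> monom_dvd m' m \<Longrightarrow> m' = m"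
  shows "\<exists>p\<in>reduced_elements. lead_monomial p = m"
proof -
  obtain g where g: "g \<in> I" "g \<noteq> 0" "lead_monomial g = m"
    using m by (auto simp: lead_monomials_def)
  define h where "h = single 0 (1 / lead_coefficient g) * g"
  have h: "h \<in> I" "h \<noteq> 0" "lead_monomial h = m"
    using g is_ideal_mult[OF I] lead_monomial_single_mult[of g] lead_coefficient_nonzero[OF g(2)]
    by (auto simp: h_def)
  have "lookup h (0 + m) = 1"
    unfolding h_def lookup_single_mult using lead_coefficient_nonzero[OF g(2)] g(3)
    by (simp add: lead_coefficient_def)
  then have mh: "lookup h m = 1" by simp
  have "lex_less k m" if "k \<in> keys (h - single m 1)" for k
  proof -
    have "k \<noteq> m" using that mh by (auto simp: in_keys_iff lookup_minus)
    moreover from this that have "k \<in> keys h"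
      by (simp add: in_keys_iff lookup_minus lookup_single_not_eq)
    ultimately show ?thesis using lex_less_lead_monomial[OF h(2)] h(3) by blast
  qed
  then obtain r where r: "h - single m 1 - r \<in> I"
      "\<forall>k\<in>keys r. lex_less k m \<and> k \<notin> lead_monomials I"
    using exists_normal_form by blast
  define p where "p = single m 1 + r"
  have "p \<in> I" using is_ideal_minus[OF I h(1) r(1)] by (simp add: p_def algebra_simps)
  have "m \<notin> keys r" using r(2) lex_irrefl by blast
  then have "lookup p m = 1" by (simp add: p_def lookup_add in_keys_iff)
  have keys: "k = m \<or> k \<in> keys r" if "k \<in> keys p" for k
    using that keys_add[of "single m 1" r] by (auto simp: p_def split: if_splits)
  have "lead_monomial p = m"
  proof (rule lead_monomial_eqI)
    show "m \<in> keys p" using \<open>lookup p m = 1\<close> by (simp add: in_keys_iff)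
    show "lex_less k m" if "k \<in> keys p" "k \<noteq> m" for k using keys that r(2) by blast
  qed
  then have "p \<in> reduced_elements"
    using \<open>p \<in> I\<close> \<open>lookup p m = 1\<close> keys r(2) min
    by (auto simp: reduced_elements_def lead_coefficient_def)
  with \<open>lead_monomial p = m\<close> show ?thesis by blast
qed

text \<open>If a leading monomial of \<open>I\<close> divides that of a basis element, it is itself
  divisible by that of some basis element, which reducedness forces to be the same one; this gives
  minimality. Conversely, minimal monomials are finitely many, and every leading monomial of
  \<open>I\<close> is a multiple of a minimal one.\<close>

theorem reduced_groebner_basis_iff: "reduced_groebner_basis I G \<longleftrightarrow> G = reduced_elements"
proof
  assume G: "reduced_groebner_basis I G"
  then have sub: "G \<subseteq> I" and monic: "\<And>p. p \<in> G \<Longrightarrow> lead_coefficient p = 1"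
    and nd: "\<And>p q m. p \<in> G \<Longrightarrow> q \<in> G \<Longrightarrow> q \<noteq> p \<Longrightarrow> m \<in> keys p \<Longrightarrow> \<not> monom_dvd (lead_monomial q) m"
    by (auto simp: reduced_groebner_basis_def groebner_basis_def monomial_in_lead_ideal_iff
        lead_monomials_def nonzero_if_monic)
  have cover: "\<exists>q\<in>G. monom_dvd (lead_monomial q) m" if "m \<in> lead_monomials I" for m
    using G that lead_ideal_eq_iff[OF sub]
    by (auto simp: reduced_groebner_basis_def groebner_basis_def lead_monomials_def)
  have GR: "p \<in> reduced_elements" if p: "p \<in> G" for p
  proof -
    have ne: "p \<noteq> 0" using monic[OF p] by (rule nonzero_if_monic)
    have "k \<notin> lead_monomials I" if k: "k \<in> keys p" "k \<noteq> lead_monomial p" for k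
    proof
      assume "k \<in> lead_monomials I"
      then obtain q where q: "q \<in> G" "monom_dvd (lead_monomial q) k" using cover by blast
      with nd p k have "q = p" by blast
      with q k monom_dvd_lex_trans lex_less_lead_monomial[OF ne k] show False
        using lex_irrefl by blast
    qed
    moreover have "m = lead_monomial p"
      if m: "m \<in> lead_monomials I" "monom_dvd m (lead_monomial p)" for m
    proof -
      obtain q where q: "q \<in> G" "monom_dvd (lead_monomial q) m" using cover m by blast
      with m have "monom_dvd (lead_monomial q) (lead_monomial p)" using monom_dvd_trans by blast
      with q nd p lead_monomial_in_keys[OF ne] have "q = p" by blast
      with q m show ?thesis by (simp add: monom_dvd_antisym)
    qed
    ultimately show ?thesis using p sub monic by (auto simp: reduced_elements_def)
  qed
  moreover have "p \<in> G" if p: "p \<in> reduced_elements" for p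
  proof -
    have "lead_monomial p \<in> lead_monomials I"
      using p nonzero_if_monic[of p] by (auto simp: reduced_elements_def lead_monomials_def)
    then obtain q where q: "q \<in> G" "monom_dvd (lead_monomial q) (lead_monomial p)"
      using cover by blast
    have "lead_monomial q \<in> lead_monomials I"
      using q sub nonzero_if_monic[OF monic] by (auto simp: lead_monomials_def)
    with p q(2) have "lead_monomial q = lead_monomial p" by (auto simp: reduced_elements_def)
    with GR[OF q(1)] p reduced_elements_lead_monomial_inj q(1) show ?thesis
      by (metis inj_onD)
  qed
  ultimately show "G = reduced_elements" by blast
next
  assume G: "G = reduced_elements"
  have ne: "p \<noteq> 0" if "p \<in> G" for p
    using that nonzero_if_monic[of p] by (auto simp: G reduced_elements_def)
  have lm: "lead_monomial p \<in> lead_monomials I" if "p \<in> G" for p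
    using that ne[OF that] by (auto simp: G reduced_elements_def lead_monomials_def)
  have "lead_monomial ` G \<subseteq> {m \<in> lead_monomials I. \<forall>m'\<in>lead_monomials I. monom_dvd m' m \<longrightarrow> m' = m}"
    using lm by (auto simp: G reduced_elements_def)
  then have "finite (lead_monomial ` G)" by (rule finite_subset) (rule finite_minimal_monoms)
  then have "finite G"
    using reduced_elements_lead_monomial_inj unfolding G by (rule finite_imageD)
  moreover have sub: "G \<subseteq> I" by (auto simp: G reduced_elements_def)
  moreover have "\<exists>m'\<in>lead_monomials G. monom_dvd m' m" if m: "m \<in> lead_monomials I" for m
  proof -
    obtain m' where m': "m' \<in> lead_monomials I" "monom_dvd m' m"
      "\<forall>m''\<in>lead_monomials I. monom_dvd m'' m' \<longrightarrow> m'' = m'"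
      using exists_minimal_monom[OF m] by blast
    then obtain p where "p \<in> G" "lead_monomial p = m'" using exists_reduced_element G by blast
    with ne m' show ?thesis by (auto simp: lead_monomials_def)
  qed
  ultimately have "groebner_basis I G"
    by (simp add: groebner_basis_def lead_ideal_eq_iff)
  moreover have "single m 1 \<notin> lead_ideal (G - {p})" if p: "p \<in> G" "m \<in> keys p" for p m
  proof
    assume "single m 1 \<in> lead_ideal (G - {p})"
    then obtain q where q: "q \<in> G" "q \<noteq> p" "monom_dvd (lead_monomial q) m"
      by (auto simp: monomial_in_lead_ideal_iff lead_monomials_def)
    then have m: "m \<in> lead_monomials I" using lm lead_monomials_dvd_closed by blast
    with p have "m = lead_monomial p" by (auto simp: G reduced_elements_def)
    with q lm p have "lead_monomial q = lead_monomial p" by (auto simp: G reduced_elements_def)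
    with p q reduced_elements_lead_monomial_inj show False by (auto simp: G dest: inj_onD)
  qed
  ultimately show "reduced_groebner_basis I G"
    by (auto simp: reduced_groebner_basis_def G reduced_elements_def)
qed

corollary the_reduced_groebner_basis_eqI:
  "reduced_groebner_basis I G \<Longrightarrow> the_reduced_groebner_basis I = G"
  unfolding the_reduced_groebner_basis_def by (rule the_equality) (simp_all add: reduced_groebner_basis_iff)

text \<open>Being valid for every ideal, it applies to the basis at whatever \<open>j\<close> the
  loop stops, where separation of first coordinates is not known.\<close>

corollary ideal_the_reduced_groebner_basis: "ideal (the_reduced_groebner_basis I) = I"
proof -
  have "reduced_groebner_basis I reduced_elements" by (simp add: reduced_groebner_basis_iff)
  then have "the_reduced_groebner_basis I = reduced_elements" "groebner_basis I reduced_elements"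
    by (simp_all add: the_reduced_groebner_basis_eqI) (simp add: reduced_groebner_basis_def)
  then show ?thesis using ideal_groebner_basis by simp
qed

end

section \<open>The shape lemma\<close>

lemma in_first_var_eq:
  "in_first_var q = (poly (map_poly Const q) (Var first_var) :: 'n::{finite,linorder} rpoly)"
proof -
  have "degree (map_poly Const q :: 'n rpoly poly) = degree q" for q :: "real poly"
    by (rule degree_map_poly) (metis Const_def lookup_single_eq lookup_zero)
  then show ?thesis
    by (simp add: in_first_var_def poly_altdef coeff_map_poly)
qed

interpretation in_first_var: comm_ring_hom "in_first_var :: real poly \<Rightarrow> 'n::{finite,linorder} rpoly"
  unfolding in_first_var_eq by (rule comm_ring_hom.comm_ring_hom_poly_map_poly[OF comm_ring_hom_Const])

lemma in_first_var_pCons: "in_first_var (pCons a q) = Const a + Var first_var * in_first_var q"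
  unfolding in_first_var_eq comm_ring_hom.map_poly_hom_pCons[OF comm_ring_hom_Const] by simp

lemma in_first_var_smult: "in_first_var (smult a q) = Const a * in_first_var q"
  unfolding in_first_var_eq comm_ring_hom.map_poly_hom_smult[OF comm_ring_hom_Const] by simp

lemma in_first_var_monom: "in_first_var (monom a k) = single (single first_var k) a"
proof (induction k)
  case 0
  show ?case by (simp add: monom_0 in_first_var_pCons in_first_var.hom_zero Const_def)
next
  case (Suc k)
  then show ?case
    by (simp add: monom_Suc in_first_var_pCons Var_def mult_single flip: single_add)
qed

lemma meval_in_first_var:
  assumes "comm_ring_hom c"
  shows "meval c x (in_first_var q) = poly (map_poly c q) (x $ first_var)"
proof -
  interpret c: comm_ring_hom c by (rule assms)
  interpret ev: comm_ring_hom "meval c x" by (rule comm_ring_hom_meval[OF assms])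
  show ?thesis
    by (induction q)
      (simp_all add: in_first_var.hom_zero ev.hom_zero ev.hom_add ev.hom_mult in_first_var_pCons
        c.map_poly_hom_pCons meval_Const[OF assms] meval_Var[OF assms])
qed

lemma single_inj_iff: "single i k = single i l \<longleftrightarrow> k = l"
  by (metis lookup_single_eq)

lemma in_first_var_eq_sum: "in_first_var q = (\<Sum>k\<le>degree q. single (single first_var k) (coeff q k))"
  by (subst poly_as_sum_of_monoms[of q, symmetric])
    (simp add: in_first_var.hom_sum in_first_var_monom)

lemma lookup_in_first_var_single: "lookup (in_first_var q) (single first_var k) = coeff q k"
proof -
  have "lookup (in_first_var q) (single first_var k)
      = (\<Sum>l\<le>degree q. if l = k then coeff q l else 0)"
    unfolding in_first_var_eq_sum lookup_sum
    by (intro sum.cong) (auto simp: lookup_single single_inj_iff when_def)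
  then show ?thesis by (cases "k \<le> degree q") (simp_all add: coeff_eq_0)
qed

lemma keys_in_first_var:
  assumes "m \<in> keys (in_first_var q)"
  obtains k where "m = single first_var k" "coeff q k \<noteq> 0"
proof -
  have "(\<Sum>k\<le>degree q. lookup (single (single first_var k) (coeff q k)) m) \<noteq> 0"
    using assms by (simp add: in_keys_iff in_first_var_eq_sum lookup_sum)
  then obtain k where "lookup (single (single first_var k) (coeff q k)) m \<noteq> 0"
    by (meson sum.not_neutral_contains_not_neutral)
  then show thesis using that by (auto simp: lookup_single when_def split: if_splits)
qed

lemma eq_in_first_var:
  fixes p :: "'n::{finite,linorder} rpoly"
  assumes "\<And>m i. m \<in> keys p \<Longrightarrow> i \<noteq> first_var \<Longrightarrow> lookup m i = 0"
  obtains q where "p = in_first_var q"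
proof
  have "m = single first_var (lookup m first_var)" if "m \<in> keys p" for m
  proof (rule poly_mapping_eqI)
    fix i show "lookup m i = lookup (single first_var (lookup m first_var)) i"
      using assms[OF that, of i] by (cases "i = first_var") (simp_all add: lookup_single)
  qed
  then have "p = (\<Sum>m\<in>keys p. in_first_var (monom (lookup p m) (lookup m first_var)))"
    by (subst poly_mapping_eq_sum[of p]) (simp add: in_first_var_monom)
  then show "p = in_first_var (\<Sum>m\<in>keys p. monom (lookup p m) (lookup m first_var))"
    by (simp only: in_first_var.hom_sum)
qed

lemma first_var_le: "first_var \<le> i"
  by (simp add: first_var_def)

lemma lex_single_first_var: "lex_less (single first_var k) (single first_var l)" if "k < l"
  using that unfolding lex_less_def by (intro exI[of _ first_var]) (auto simp: lookup_single when_def)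

text \<open>The exponents at \<open>i\<close> decide, as both vanish beyond it. Hence the variable
  \<open>i\<close> leads in \<open>Var i - in_first_var q\<close> whatever the degree of
  \<open>q\<close>.\<close>

lemma lex_single_first_var_Var: "lex_less (single first_var k) (single i 1)" if "i \<noteq> first_var"
proof -
  have "l \<noteq> first_var" if "l > i" for l :: 'a
    using that first_var_le[of i] by auto
  with that show ?thesis
    unfolding lex_less_def by (intro exI[of _ i]) (auto simp: lookup_single when_def)
qed

lemma lead_monomial_in_first_var:
  assumes "q \<noteq> 0"
  shows "lead_monomial (in_first_var q) = single first_var (degree q)"
proof (rule lead_monomial_eqI)
  show "single first_var (degree q) \<in> keys (in_first_var q)"
    using assms by (simp add: in_keys_iff lookup_in_first_var_single)
  fix m assume "m \<in> keys (in_first_var q)" "m \<noteq> single first_var (degree q)"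
  then obtain k where k: "m = single first_var k" "coeff q k \<noteq> 0" "k \<noteq> degree q"
    by (metis keys_in_first_var)
  then have "k < degree q" using le_degree[of q k] by simp
  then show "lex_less m (single first_var (degree q))" by (simp add: k lex_single_first_var)
qed

lemma keys_Var_minus_in_first_var:
  assumes "m \<in> keys (Var i - in_first_var q)"
  shows "m = single i 1 \<or> (\<exists>k. m = single first_var k \<and> coeff q k \<noteq> 0)"
proof -
  have "m \<in> keys (Var i) \<or> m \<in> keys (in_first_var q)"
    using assms keys_minus[of "Var i" "in_first_var q"] by blast
  then show ?thesis
    by (auto simp: Var_def elim: keys_in_first_var)
qed

lemma lookup_Var_minus_in_first_var:
  "i \<noteq> first_var \<Longrightarrow> lookup (Var i - in_first_var q) (single i 1) = 1"
  by (simp add: lookup_minus lookup_in_first_var[of i q, simplified] Var_def)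

lemma lead_monomial_Var_minus_in_first_var:
  assumes "i \<noteq> first_var"
  shows "lead_monomial (Var i - in_first_var q) = single i 1"
proof (rule lead_monomial_eqI)
  show "single i 1 \<in> keys (Var i - in_first_var q)"
    using lookup_Var_minus_in_first_var[OF assms, of q] by (simp add: in_keys_iff)
  fix m assume "m \<in> keys (Var i - in_first_var q)" "m \<noteq> single i 1"
  then show "lex_less m (single i 1)"
    using keys_Var_minus_in_first_var[of m i q] lex_single_first_var_Var[OF assms] by auto
qed

section \<open>Interpolation with real coefficients\<close>

lemma exists_interpolating_poly:
  fixes g :: "'k::field \<Rightarrow> 'k"
  assumes "finite S"
  shows "\<exists>p. \<forall>a\<in>S. poly p a = g a"
  using assms
proof induction
  case (insert x S)
  then obtain p where p: "\<forall>a\<in>S. poly p a = g a" by blast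
  define d where "d = (\<Prod>a\<in>S. [:- a, 1:])"
  have "poly d a = 0 \<longleftrightarrow> a \<in> S" for a
    using insert.hyps(1) by (auto simp: d_def poly_prod prod_zero_iff)
  then have "poly (p + smult ((g x - poly p x) / poly d x) d) a = g a" if "a \<in> insert x S" for a
    using p insert.hyps(2) that by (auto simp: field_simps)
  then show ?case by blast
qed simp

text \<open>Taking real parts of the coefficients averages a complex interpolant with its conjugate.
  On conjugation-invariant data both take the same values.\<close>

lemma exists_real_interpolating_poly:
  fixes g :: "complex \<Rightarrow> complex"
  assumes "finite S" and cnj: "\<And>a. a \<in> S \<Longrightarrow> cnj a \<in> S" "\<And>a. a \<in> S \<Longrightarrow> g (cnj a) = cnj (g a)"
  shows "\<exists>q. \<forall>a\<in>S. poly (map_poly complex_of_real q) a = g a"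
proof -
  obtain p where p: "\<forall>a\<in>S. poly p a = g a" using exists_interpolating_poly assms(1) by blast
  define q where "q = map_poly Re p"
  have q: "smult 2 (map_poly complex_of_real q) = p + map_poly cnj p"
    by (rule poly_eqI) (simp add: q_def coeff_map_poly complex_add_cnj)
  have cnj_poly: "poly (map_poly cnj r) a = cnj (poly r (cnj a))" for r a
    by (induction r) (simp_all add: map_poly_pCons)
  have "poly (map_poly complex_of_real q) a = g a" if a: "a \<in> S" for a
  proof -
    have "2 * poly (map_poly complex_of_real q) a = poly p a + cnj (poly p (cnj a))"
      using arg_cong[OF q, of "\<lambda>r. poly r a"] by (simp add: cnj_poly)
    then show ?thesis using p cnj a by simp
  qed
  then show ?thesis by blast
qed

lemma exists_real_vanishing_poly:
  assumes "finite S"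
  obtains q where "q \<noteq> 0" "\<And>a. a \<in> S \<Longrightarrow> poly (map_poly complex_of_real q) a = 0"
proof
  \<comment> \<open>The product of \<open>t - a\<close> and \<open>t - cnj a\<close>, which has real
    coefficients.\<close>
  define h where "h a = [: (norm a)\<^sup>2, - 2 * Re a, 1:]" for a :: complex
  show "(\<Prod>a\<in>S. h a) \<noteq> 0" using assms by (simp add: h_def)
  interpret ev: comm_ring_hom "\<lambda>p. poly (map_poly complex_of_real p) a" for a
    by (rule comm_ring_hom.comm_ring_hom_poly_map_poly[OF comm_ring_hom_of_real])
  have "poly (map_poly complex_of_real (h a)) a = 0" for a
  proof -
    have "poly (map_poly complex_of_real (h a)) a = a * cnj a + a * (a - (a + cnj a))"
      by (simp add: h_def map_poly_pCons complex_norm_square complex_add_cnj algebra_simps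
          del: complex_mult_cnj of_real_power)
    then show ?thesis by (simp add: algebra_simps)
  qed
  then show "poly (map_poly complex_of_real (\<Prod>a\<in>S. h a)) a = 0" if "a \<in> S" for a
    using that assms by (auto simp: ev.hom_prod)
qed

lemma V_complex_cnj:
  assumes "z \<in> V_complex I"
  shows "(\<chi> i. cnj (z $ i)) \<in> V_complex I"
proof -
  have "comm_ring_hom cnj" by unfold_locales simp_all
  then have "cnj (eval_complex p z) = eval_complex p (\<chi> i. cnj (z $ i))" for p
    by (subst hom_meval[OF comm_ring_hom_of_real]) simp_all
  with assms show ?thesis by (simp add: V_complex_def) (metis complex_cnj_zero)
qed

text \<open>The leading monomials are a power of the first variable and all other variables. The
  degree bounds serve reducedness: the \<open>v $ i\<close> must avoid the leading monomial of
  \<open>w\<close>, and \<open>w\<close> must not be constant, since 1 divides every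
  monomial.\<close>

lemma groebner_basis_of_shape:
  fixes I :: "'n::{finite,linorder} rpoly set"
  assumes I: "is_ideal I"
    and w: "in_first_var w \<in> I" "lead_coeff w = 1"
    and w_min: "\<And>q. q \<noteq> 0 \<Longrightarrow> in_first_var q \<in> I \<Longrightarrow> degree w \<le> degree q"
    and v: "\<And>i. i \<noteq> first_var \<Longrightarrow> Var i - in_first_var (v $ i) \<in> I"
    and deg_v: "\<And>i k. i \<noteq> first_var \<Longrightarrow> coeff (v $ i) k \<noteq> 0 \<Longrightarrow> k < degree w"
    and deg_w: "\<And>i::'n. i \<noteq> first_var \<Longrightarrow> degree w > 0"
  shows "reduced_groebner_basis I
    (insert (in_first_var w) ((\<lambda>i. Var i - in_first_var (v $ i)) ` (- {first_var})))"
    (is "reduced_groebner_basis I ?G")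
proof -
  let ?h = "\<lambda>i. Var i - in_first_var (v $ i)"
  have w0: "w \<noteq> 0" using w(2) by auto
  have lmw: "lead_monomial (in_first_var w :: 'n rpoly) = single first_var (degree w)"
    by (rule lead_monomial_in_first_var[OF w0])
  have lmh: "lead_monomial (?h i) = single i 1" if "i \<noteq> first_var" for i
    by (rule lead_monomial_Var_minus_in_first_var[OF that])
  have "lead_coefficient (in_first_var w :: 'n rpoly) = 1"
    using w(2) by (simp add: lead_coefficient_def lmw lookup_in_first_var_single)
  moreover have "lead_coefficient (?h i) = 1" if "i \<noteq> first_var" for i
    unfolding lead_coefficient_def lmh[OF that] by (rule lookup_Var_minus_in_first_var[OF that])
  ultimately have monic: "lead_coefficient p = 1" if "p \<in> ?G" for p
    using that by auto
  have lms: "lead_monomials ?G = insert (single first_var (degree w)) ((\<lambda>i. single i 1) ` (- {first_var}))"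
  proof -
    have "?G - {0} = ?G" using monic nonzero_if_monic[OF I] by blast
    moreover have "lead_monomial ` ?h ` (- {first_var}) = (\<lambda>i. single i 1) ` (- {first_var})"
      unfolding image_image by (rule image_cong) (simp_all add: lmh del: One_nat_def)
    ultimately show ?thesis unfolding lead_monomials_def by (simp only: image_insert lmw)
  qed
  have sub: "?G \<subseteq> I" using w v by auto
  have "\<exists>m'\<in>lead_monomials ?G. monom_dvd m' m" if m: "m \<in> lead_monomials I" for m
  proof (cases "\<exists>i. i \<noteq> first_var \<and> lookup m i \<noteq> 0")
    case True
    then obtain i where i: "i \<noteq> first_var" "lookup m i \<noteq> 0" by blast
    then have "monom_dvd (single i 1) m"
      by (auto simp: monom_dvd_def lookup_single when_def)
    with i show ?thesis unfolding lms by blast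
  next
    case False
    obtain p where p: "p \<in> I" "p \<noteq> 0" "lead_monomial p = m" using m by (rule lead_monomialsE)
    \<comment> \<open>Elimination property of the lexicographic order: below a power of the first
      variable there are only such powers. So \<open>p\<close> is univariate and the minimality of
      \<open>w\<close> applies.\<close>
    have "lookup k i = 0" if k: "k \<in> keys p" and i: "i \<noteq> first_var" for k i
    proof (cases "k = m")
      case True
      then show ?thesis using False i by blast
    next
      case ne: False
      then obtain l where l: "lookup k l < lookup m l" "\<forall>l'>l. lookup k l' = lookup m l'"
        using lex_less_lead_monomial[OF p(2) k] p(3) by (auto simp: lex_less_def)
      then have "l = first_var" using False by (metis less_zeroE)
      with l(2) i False show ?thesis
        using first_var_le[of i] by (metis order_le_imp_less_or_eq)
    qed
    then obtain q where q: "p = in_first_var q" by (rule eq_in_first_var)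
    with p have "q \<noteq> 0" by (auto simp: in_first_var.hom_zero)
    with w_min p q have "degree w \<le> degree q" by blast
    moreover have "m = single first_var (degree q)"
      unfolding p(3)[symmetric] q by (rule lead_monomial_in_first_var[OF \<open>q \<noteq> 0\<close>])
    ultimately have "monom_dvd (single first_var (degree w)) m"
      by (auto simp: monom_dvd_def lookup_single when_def)
    then show ?thesis unfolding lms by blast
  qed
  then have "groebner_basis I ?G"
    using lead_ideal_eq_iff[OF sub] sub by (simp add: groebner_basis_def)
  moreover have "\<not> monom_dvd (lead_monomial q) m" if p: "p \<in> ?G" and m: "m \<in> keys p"
    and q: "q \<in> ?G" "q \<noteq> p" for p q m
  proof (cases "p = in_first_var w")
    case True
    with q obtain i where i: "i \<noteq> first_var" "q = ?h i" by auto
    from m True obtain k where "m = single first_var k" by (auto elim: keys_in_first_var)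
    with i have "lookup (lead_monomial q) i > lookup m i" by (simp add: lmh lookup_single)
    then show ?thesis by (auto simp: monom_dvd_def not_le)
  next
    case False
    with p obtain i where i: "i \<noteq> first_var" "p = ?h i" by auto
    with m have m: "m = single i 1 \<or> (\<exists>k<degree w. m = single first_var k)"
      using keys_Var_minus_in_first_var[of m i "v $ i"] deg_v by blast
    show ?thesis
    proof (cases "q = in_first_var w")
      case True
      with m i deg_w[OF i(1)] have "lookup (lead_monomial q) first_var > lookup m first_var"
        by (auto simp: lmw lookup_single)
      then show ?thesis by (auto simp: monom_dvd_def not_le)
    next
      case False
      with q obtain i' where i': "i' \<noteq> first_var" "q = ?h i'" by auto
      with q i have "i' \<noteq> i" by blast
      with m i' have "lookup (lead_monomial q) i' > lookup m i'"
        by (auto simp: lmh lookup_single)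
      then show ?thesis by (auto simp: monom_dvd_def not_le)
    qed
  qed
  then have "single m 1 \<notin> lead_ideal (?G - {p})" if "p \<in> ?G" "m \<in> keys p" for p m
    using that unfolding monomial_in_lead_ideal_iff by (blast elim: lead_monomialsE)
  ultimately show ?thesis
    unfolding reduced_groebner_basis_def using monic by blast
qed

text \<open>\<open>I\<close> contains whatever vanishes on its zeros, and these are determined by
  their first coordinates. Interpolating the other coordinates over the first ones thus yields
  members of \<open>I\<close>. Nonemptiness keeps \<open>w\<close> from being constant.\<close>

theorem shape_lemma:
  fixes I :: "'n::{finite,linorder} rpoly set"
  assumes I: "is_ideal I"
    and vanishing: "\<And>p. (\<And>z. z \<in> V_complex I \<Longrightarrow> eval_complex p z = 0) \<Longrightarrow> p \<in> I"
    and fin: "finite (V_complex I)"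
    and inj: "inj_on (\<lambda>z. z $ first_var) (V_complex I)"
    and ne: "CARD('n) \<ge> 2 \<longrightarrow> V_complex I \<noteq> {}"
  shows "\<exists>w v. has_shape (the_reduced_groebner_basis I) w v"
proof -
  define S where "S = (\<lambda>z. z $ first_var) ` V_complex I"
  have finS: "finite S" using fin by (simp add: S_def)
  have cnjS: "cnj a \<in> S" if a: "a \<in> S" for a
  proof -
    obtain z where "z \<in> V_complex I" "a = z $ first_var" using a by (auto simp: S_def)
    then show ?thesis
      unfolding S_def by (intro image_eqI[OF _ V_complex_cnj]) simp_all
  qed
  have ev: "eval_complex (in_first_var q) z = poly (map_poly complex_of_real q) (z $ first_var)"
    for q and z :: "complex ^ 'n::{finite,linorder}" by (rule meval_in_first_var[OF comm_ring_hom_of_real])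
  obtain w0 where w0: "w0 \<noteq> 0" "\<And>a. a \<in> S \<Longrightarrow> poly (map_poly complex_of_real w0) a = 0"
    using exists_real_vanishing_poly[OF finS] by blast
  have "in_first_var w0 \<in> I"
    by (rule vanishing) (simp add: ev w0 S_def)
  \<comment> \<open>An element of least degree generates the elimination ideal in the first
    variable; scaling makes it the monic \<open>w\<close>.\<close>
  with w0(1) obtain w1 where w1: "w1 \<noteq> 0" "in_first_var w1 \<in> I"
    and w1_min: "\<And>q. q \<noteq> 0 \<and> in_first_var q \<in> I \<Longrightarrow> degree w1 \<le> degree q"
    using ex_has_least_nat[of "\<lambda>q. q \<noteq> 0 \<and> in_first_var q \<in> I" w0 degree] by blast
  define w where "w = smult (1 / lead_coeff w1) w1"
  have w: "in_first_var w \<in> I" "lead_coeff w = 1" "degree w = degree w1"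
    using w1 is_ideal_mult[OF I] by (auto simp: w_def in_first_var_smult)
  then have "w \<noteq> 0" by auto
  have "\<exists>u. Var i - in_first_var u \<in> I" for i
  proof -
    \<comment> \<open>Reads coordinate \<open>i\<close> off the first coordinate; on
      \<open>S\<close> this is unambiguous because the first coordinates are distinct.\<close>
    define g where "g a = (inv_into (V_complex I) (\<lambda>z. z $ first_var) a) $ i" for a
    have g: "g (z $ first_var) = z $ i" if "z \<in> V_complex I" for z
      using inv_into_f_f[OF inj that] by (simp add: g_def)
    have "g (cnj a) = cnj (g a)" if a: "a \<in> S" for a
    proof -
      obtain z where z: "z \<in> V_complex I" "a = z $ first_var" using a by (auto simp: S_def)
      then show ?thesis using g[OF z(1)] g[OF V_complex_cnj[OF z(1)]] by simp
    qed
    then obtain u where u: "\<forall>a\<in>S. poly (map_poly complex_of_real u) a = g a"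
      using exists_real_interpolating_poly[OF finS cnjS] by blast
    have "Var i - in_first_var u \<in> I"
      by (rule vanishing)
        (use u g in \<open>simp add: eval_complex.hom_minus ev meval_Var[OF comm_ring_hom_of_real] S_def\<close>)
    then show ?thesis by blast
  qed
  then obtain u where u: "\<And>i. Var i - in_first_var (u i) \<in> I" by metis
  \<comment> \<open>Remainders modulo \<open>w\<close> meet the degree bound of a reduced basis and
    change the generators only by members of \<open>I\<close>. The first entry is the indeterminate
    demanded by \<open>has_shape\<close>.\<close>
  define v :: "real poly ^ 'n::{finite,linorder}" where "v = (\<chi> i. if i = first_var then [:0, 1:] else u i mod w)"
  have "Var i - in_first_var (v $ i) \<in> I" if "i \<noteq> first_var" for i
  proof -
    have "(in_first_var (u i) :: 'n rpoly) = in_first_var (u i div w) * in_first_var w + in_first_var (u i mod w)"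
      by (simp flip: in_first_var.hom_mult in_first_var.hom_add)
    then have "Var i - in_first_var (v $ i)
        = (Var i - in_first_var (u i)) + in_first_var (u i div w) * in_first_var w"
      using that by (simp add: v_def)
    also have "\<dots> \<in> I"
      by (intro is_ideal_add[OF I] is_ideal_mult[OF I] u w)
    finally show ?thesis .
  qed
  moreover have "k < degree w" if "i \<noteq> first_var" "coeff (v $ i) k \<noteq> 0" for i k
    using that degree_mod_less[OF \<open>w \<noteq> 0\<close>, of "u i"] le_degree[of "u i mod w" k] by (auto simp: v_def)
  moreover have "degree w > 0" if i: "i \<noteq> first_var" for i :: 'n
  proof (rule ccontr)
    assume "\<not> degree w > 0"
    with w(2) have "w = 1" by (auto elim!: degree_eq_zeroE simp: one_pCons)
    with w(1) have "1 \<in> I" by (simp add: in_first_var.hom_one)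
    then have "V_complex I = {}" by (force simp: V_complex_def eval_complex.hom_one)
    moreover have "CARD('n) \<ge> 2" using card_mono[of UNIV "{i, first_var}"] i by simp
    ultimately show False using ne by blast
  qed
  ultimately have "reduced_groebner_basis I
      (insert (in_first_var w) ((\<lambda>i. Var i - in_first_var (v $ i)) ` (- {first_var})))"
    using w w1_min by (intro groebner_basis_of_shape[OF I]) auto
  then have "has_shape (the_reduced_groebner_basis I) w v"
    by (simp add: the_reduced_groebner_basis_eqI[OF I] has_shape_def v_def)
  then show ?thesis by blast
qed

section \<open>Linear changes of variables\<close>

lemma partial_deriv_single:
  "partial_deriv i (single m a) = single (m - single i 1) (of_nat (lookup m i) * a)"
  by (simp add: partial_deriv_def)

lemma partial_deriv_add: "partial_deriv i (p + q) = partial_deriv i p + partial_deriv i q"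
  unfolding partial_deriv_def
  by (rule setsum_keys_plus_distrib) (simp_all add: distrib_left single_add)

lemma partial_deriv_0: "partial_deriv i 0 = 0"
  by (simp add: partial_deriv_def)

lemma partial_deriv_sum: "partial_deriv i (sum p S) = (\<Sum>k\<in>S. partial_deriv i (p k))"
  by (induction S rule: infinite_finite_induct) (simp_all add: partial_deriv_0 partial_deriv_add)

lemma partial_deriv_Const: "partial_deriv i (Const a) = 0"
  by (simp add: Const_def partial_deriv_single)

lemma partial_deriv_Var: "partial_deriv i (Var k) = (if i = k then 1 else 0)"
  by (simp add: Var_def partial_deriv_single lookup_single)

lemma partial_deriv_mult: "partial_deriv i (p * q) = partial_deriv i p * q + p * partial_deriv i q"
proof (induction p rule: poly_mapping_add_induct)
  case (single m a)
  show ?case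
  proof (induction q rule: poly_mapping_add_induct)
    case (single n b)
    \<comment> \<open>Exponent subtraction truncates, so moving it past \<open>t\<close> requires
      that \<open>i\<close> occur in \<open>s\<close>; otherwise the coefficient is 0 and both sides
      vanish.\<close>
    have shift: "single (s + t - single i 1) (of_nat (lookup s i) * c)
        = single (s - single i 1 + t) (of_nat (lookup s i) * c)" for s t and c :: real
    proof (cases "lookup s i = 0")
      case False
      have "s + t - single i 1 = s - single i 1 + t"
        by (rule poly_mapping_eqI) (use False in \<open>auto simp: lookup_add lookup_minus lookup_single when_def\<close>)
      then show ?thesis by simp
    qed simp
    show ?case
      using shift[of m n "a * b"] shift[of n m "a * b"]
      by (simp add: mult_single partial_deriv_single lookup_add distrib_left distrib_right single_add
          mult.assoc mult.left_commute add.commute del: One_nat_def)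
  next
    case (add p q)
    then show ?case by (simp add: partial_deriv_add algebra_simps)
  qed
next
  case (add p q)
  then show ?case by (simp add: partial_deriv_add algebra_simps)
qed

section \<open>Linear substitution and the chain rule\<close>

lemma meval_transform:
  assumes c: "comm_ring_hom c"
  shows "meval c y (transform A f) = meval c (map_matrix c (matrix_inv A) *v y) f"
proof -
  interpret ev: comm_ring_hom "meval c y" by (rule comm_ring_hom_meval[OF c])
  show ?thesis
    unfolding transform_def
    by (subst hom_meval[OF comm_ring_hom_Const ev.comm_ring_hom_axioms])
      (simp add: meval_Const[OF c] meval_Var[OF c] matrix_vector_mult_def ev.hom_sum ev.hom_mult)
qed

text \<open>Both sides are additive in \<open>f\<close> and satisfy the product rule relative to the
  homomorphism \<open>transform A\<close>, so agreement on constants and variables suffices.\<close>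

lemma partial_deriv_transform:
  "partial_deriv i (transform A f)
    = (\<Sum>k\<in>UNIV. Const (matrix_inv A $ k $ i) * transform A (partial_deriv k f))"
proof -
  interpret T: comm_ring_hom "transform A"
    unfolding transform_def by (rule comm_ring_hom_meval[OF comm_ring_hom_Const])
  let ?d = "\<lambda>f. \<Sum>k\<in>UNIV. Const (matrix_inv A $ k $ i) * transform A (partial_deriv k f)"
  have T_Const: "transform A (Const a) = Const a" for a
    by (simp add: transform_def meval_Const[OF comm_ring_hom_Const])
  have T_Var: "transform A (Var k) = (\<Sum>l\<in>UNIV. Const (matrix_inv A $ k $ l) * Var l)" for k
    by (simp add: transform_def meval_Var[OF comm_ring_hom_Const] matrix_vector_mult_def)
  show ?thesis
  proof (induction f rule: mpoly_induct)
    case (Const a)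
    show ?case by (simp add: T_Const partial_deriv_Const T.hom_zero)
  next
    case (Var k)
    have "partial_deriv i (transform A (Var k)) = Const (matrix_inv A $ k $ i)"
      unfolding T_Var
      by (simp add: partial_deriv_sum partial_deriv_mult partial_deriv_Const partial_deriv_Var
          if_distrib[of "\<lambda>x. _ * x"] cong: if_cong)
    moreover have "?d (Var k) = Const (matrix_inv A $ k $ i)"
      by (simp add: partial_deriv_Var T.hom_zero T.hom_one if_distrib[of "transform A"]
          if_distrib[of "\<lambda>x. _ * x"] cong: if_cong)
    ultimately show ?case by simp
  next
    case (add f g)
    then show ?case
      by (simp add: partial_deriv_add T.hom_add distrib_left sum.distrib)
  next
    case (mult f g)
    have "?d (f * g) = ?d f * transform A g + transform A f * ?d g"
      unfolding partial_deriv_mult T.hom_add T.hom_mult distrib_left sum.distrib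
        sum_distrib_left sum_distrib_right
      by (simp add: mult.assoc mult.left_commute)
    with mult show ?case by (simp add: T.hom_mult partial_deriv_mult)
  qed
qed

text \<open>The parameter \<open>c\<close> lets one transformation rule serve the complex critical
  points, needed for termination, and the real ones, needed for the output.\<close>

definition gradient :: "(real \<Rightarrow> 'b::comm_ring_1) \<Rightarrow> 'b ^ 'n \<Rightarrow> 'n::finite rpoly \<Rightarrow> 'b ^ 'n" where
  "gradient c x f = (\<chi> i. meval c x (partial_deriv i f))"

lemma gradient_transform:
  assumes c: "comm_ring_hom c"
  shows "gradient c y (transform A f)
    = gradient c (map_matrix c (matrix_inv A) *v y) f v* map_matrix c (matrix_inv A)"
proof -
  interpret ev: comm_ring_hom "meval c y" by (rule comm_ring_hom_meval[OF c])
  show ?thesis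
    by (simp add: vec_eq_iff gradient_def partial_deriv_transform ev.hom_sum ev.hom_mult
        meval_Const[OF c] meval_transform[OF c] vector_matrix_mult_def mult.commute)
qed

text \<open>The chain rule applied twice; as the substitution is linear, first derivatives of
  \<open>f\<close> do not appear. The result is a congruence, which preserves positive
  definiteness.\<close>

lemma eval_hessian_transform:
  "map_matrix (\<lambda>p. eval_real p y) (hessian (transform A f))
    = transpose (matrix_inv A)
      ** map_matrix (\<lambda>p. eval_real p (matrix_inv A *v y)) (hessian f) ** matrix_inv A"
proof -
  have id: "map_matrix (\<lambda>a. a) B = B" for B :: "real ^ 'n ^ 'n" by (simp add: vec_eq_iff)
  have "eval_real (partial_deriv i (partial_deriv k (transform A f))) y
      = (\<Sum>b\<in>UNIV. matrix_inv A $ b $ k * (\<Sum>a\<in>UNIV. matrix_inv A $ a $ i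
          * eval_real (partial_deriv a (partial_deriv b f)) (matrix_inv A *v y)))" for i k
    by (simp add: partial_deriv_transform partial_deriv_sum partial_deriv_mult partial_deriv_Const
        eval_real_simps meval_transform[OF comm_ring_hom_id] id)
  then show ?thesis
    by (simp add: vec_eq_iff hessian_def matrix_matrix_mult_def transpose_def mult.commute)
qed

lemma map_matrix_hom_mult:
  assumes "comm_ring_hom c"
  shows "map_matrix c (A ** B) = map_matrix c A ** map_matrix c B"
proof -
  interpret c: comm_ring_hom c by (rule assms)
  show ?thesis by (simp add: vec_eq_iff matrix_matrix_mult_def c.hom_sum c.hom_mult)
qed

lemma map_matrix_hom_mat_1:
  assumes "comm_ring_hom c"
  shows "map_matrix c (mat 1) = mat 1"
proof -
  interpret c: comm_ring_hom c by (rule assms)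
  show ?thesis by (simp add: vec_eq_iff mat_def c.hom_one c.hom_zero)
qed

lemma matrix_inv_inverse:
  assumes "invertible A"
  shows "A ** matrix_inv A = mat 1" and "matrix_inv A ** A = mat 1"
proof -
  have "A ** matrix_inv A = mat 1 \<and> matrix_inv A ** A = mat 1"
    using assms unfolding invertible_def matrix_inv_def by (rule someI_ex)
  then show "A ** matrix_inv A = mat 1" "matrix_inv A ** A = mat 1" by simp_all
qed

lemma map_matrix_inv:
  fixes A :: "real ^ 'n ^ 'n"
  assumes c: "comm_ring_hom c" and A: "invertible A"
  shows "map_matrix c A ** map_matrix c (matrix_inv A) = mat 1"
    and "map_matrix c (matrix_inv A) ** map_matrix c A = mat 1"
  using matrix_inv_inverse[OF A]
  by (simp_all add: map_matrix_hom_mat_1[OF c] flip: map_matrix_hom_mult[OF c])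

lemma gradient_transform_eq_0_iff:
  assumes c: "comm_ring_hom c" and A: "invertible A"
  shows "gradient c y (transform A f) = 0 \<longleftrightarrow> gradient c (map_matrix c (matrix_inv A) *v y) f = 0"
proof -
  have "x = 0" if "x v* map_matrix c (matrix_inv A) = 0" for x
  proof -
    have "x v* (map_matrix c (matrix_inv A) ** map_matrix c A) = 0"
      unfolding vector_matrix_mul_assoc[symmetric] that by simp
    then show ?thesis by (simp add: map_matrix_inv[OF c A])
  qed
  then show ?thesis by (auto simp: gradient_transform[OF c])
qed

lemma mem_V_complex_gradient_ideal:
  "z \<in> V_complex (gradient_ideal f) \<longleftrightarrow> gradient complex_of_real z f = 0"
  unfolding gradient_ideal_def V_complex_ideal by (auto simp: gradient_def vec_eq_iff)

lemma mem_V_real_gradient_ideal: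
  "x \<in> V_real (gradient_ideal f) \<longleftrightarrow> gradient (\<lambda>a. a) x f = 0"
  unfolding gradient_ideal_def V_real_ideal by (auto simp: gradient_def vec_eq_iff)

section \<open>The transformation matrices\<close>

lemma transf_matrix_mult_nth:
  "i \<noteq> first_var \<Longrightarrow> (transf_matrix j *v x) $ i = x $ i"
  by (simp add: transf_matrix_def matrix_vector_mult_def mat_def if_distrib[of "\<lambda>x. x * _"] cong: if_cong)

lemma invertible_transf_matrix:
  "invertible (transf_matrix j :: real ^ 'n::{finite,linorder} ^ 'n::{finite,linorder})"
proof -
  have "x = 0" if x: "transf_matrix j *v x = 0" for x :: "real ^ 'n::{finite,linorder}"
  proof -
    have other: "x $ i = 0" if "i \<noteq> first_var" for i
      using transf_matrix_mult_nth[OF that, of j x] x by simp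
    have "0 = (transf_matrix j *v x) $ first_var" using x by simp
    also have "\<dots> = (\<Sum>k::'n\<in>UNIV. if k = first_var then x $ first_var else 0)"
    proof -
      \<comment> \<open>No index precedes the first one, so this entry is \<open>j ^ 0 = 1\<close>,
        also for \<open>j = 0\<close>.\<close>
      have empty: "{..<first_var} = ({} :: 'n set)" using first_var_le by (auto simp: not_less[symmetric])
      show ?thesis
        unfolding transf_matrix_def matrix_vector_mult_def
        unfolding vec_lambda_beta by (intro sum.cong refl) (auto simp: other empty)
    qed
    finally have "x $ first_var = 0" by simp
    with other show ?thesis by (metis vec_eq_iff zero_index)
  qed
  then show ?thesis
    using matrix_left_invertible_ker[of "transf_matrix j :: real ^ 'n::{finite,linorder} ^ 'n::{finite,linorder}"] invertible_left_inverse by blast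
qed

text \<open>The first coordinate of the transformed \<open>z\<close> is the value at
  \<open>j\<close> of a polynomial with the entries of \<open>z\<close> as coefficients. Distinct
  points give distinct polynomials, which agree at only finitely many \<open>j\<close>.\<close>

lemma exists_separating_transf_matrix:
  fixes V :: "(complex ^ 'n::{finite,linorder}) set"
  assumes "finite V"
  obtains j where "inj_on (\<lambda>z. (map_matrix complex_of_real (transf_matrix j) *v z) $ first_var) V"
proof -
  define P :: "complex ^ 'n::{finite,linorder} \<Rightarrow> complex poly"
    where "P z = (\<Sum>k\<in>UNIV. monom (z $ k) (card {..<k}))" for z
  have inj: "card {..<k} = card {..<l} \<longleftrightarrow> k = l" for k l :: 'n
  proof -
    have "card {..<k} < card {..<l}" if "k < l" for k l :: 'n
      using that by (intro psubset_card_mono) auto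
    then show ?thesis by (metis less_irrefl linorder_less_linear)
  qed
  have coeff: "coeff (P z) (card {..<k}) = z $ k" for z k
    by (simp add: P_def coeff_sum inj)
  have first: "(map_matrix complex_of_real (transf_matrix j) *v z) $ first_var = poly (P z) (of_nat j)"
    for j z
    by (simp add: P_def poly_sum poly_monom transf_matrix_def matrix_vector_mult_def mult.commute)
  define bad where "bad = (\<Union>(z, z')\<in>{(z, z') \<in> V \<times> V. z \<noteq> z'}. {a. poly (P z - P z') a = 0})"
  have "finite {a. poly (P z - P z') a = 0}" if ne: "z \<noteq> z'" for z z'
  proof (rule poly_roots_finite)
    obtain k where "z $ k \<noteq> z' $ k" using ne by (auto simp: vec_eq_iff)
    then have "coeff (P z - P z') (card {..<k}) \<noteq> 0" by (simp add: coeff)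
    then show "P z - P z' \<noteq> 0" by auto
  qed
  moreover have "finite {(z, z') \<in> V \<times> V. z \<noteq> z'}"
    by (rule finite_subset[of _ "V \<times> V"]) (use assms in auto)
  ultimately have "finite bad" unfolding bad_def by auto
  moreover have "infinite (range (of_nat :: nat \<Rightarrow> complex))"
    by (simp add: range_inj_infinite)
  ultimately obtain j where "(of_nat j :: complex) \<notin> bad"
    by (metis (no_types, opaque_lifting) finite_subset image_subset_iff)
  then have "inj_on (\<lambda>z. (map_matrix complex_of_real (transf_matrix j) *v z) $ first_var) V"
    unfolding first by (auto simp: inj_on_def bad_def)
  then show thesis by (rule that)
qed

text \<open>The zeros of the transformed ideal are the images of the original ones under
  \<open>A\<close>, so finiteness and nonemptiness carry over, and the choice of \<open>j\<close>
  separates first coordinates.\<close>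

lemma exists_has_shape:
  fixes f :: "'n::{finite,linorder} rpoly"
  assumes fin: "zero_dimensional (gradient_ideal f)"
    and ne: "CARD('n) \<ge> 2 \<longrightarrow> V_complex (gradient_ideal f) \<noteq> {}"
  shows "\<exists>j w v. has_shape (basis_at f j) w v"
proof -
  let ?V = "V_complex (gradient_ideal f)"
  have finV: "finite ?V" using fin by (simp add: zero_dimensional_def)
  obtain j where j: "inj_on (\<lambda>z. (map_matrix complex_of_real (transf_matrix j) *v z) $ first_var) ?V"
    by (rule exists_separating_transf_matrix[OF finV])
  define A :: "real ^ 'n::{finite,linorder} ^ 'n::{finite,linorder}" where "A = transf_matrix j"
  define I where "I = gradient_ideal (transform A f)"
  have A: "invertible A" unfolding A_def by (rule invertible_transf_matrix)
  let ?A = "map_matrix complex_of_real A" and ?B = "map_matrix complex_of_real (matrix_inv A)"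
  note inv = map_matrix_inv[OF comm_ring_hom_of_real A]
  have AB: "?A *v (?B *v y) = y" and BA: "?B *v (?A *v y) = y" for y
    by (simp_all add: matrix_vector_mul_assoc inv)
  have mem: "y \<in> V_complex I \<longleftrightarrow> ?B *v y \<in> ?V" for y
    unfolding I_def mem_V_complex_gradient_ideal
    by (rule gradient_transform_eq_0_iff[OF comm_ring_hom_of_real A])
  have V: "V_complex I = (*v) ?A ` ?V"
  proof
    show "V_complex I \<subseteq> (*v) ?A ` ?V" using mem AB by (metis image_eqI subsetI)
    show "(*v) ?A ` ?V \<subseteq> V_complex I" using mem BA by auto
  qed
  have I: "is_ideal I" by (simp add: I_def gradient_ideal_def is_ideal_ideal)
  have "\<exists>w v. has_shape (the_reduced_groebner_basis (radical I)) w v"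
  proof (rule shape_lemma[OF is_ideal_radical[OF I]], unfold V_complex_radical)
    show "p \<in> radical I" if "\<And>z. z \<in> V_complex I \<Longrightarrow> eval_complex p z = 0" for p
      using real_nullstellensatz_complex_zeros[OF I] that .
    show "finite (V_complex I)" unfolding V using finV by simp
    show "inj_on (\<lambda>z. z $ first_var) (V_complex I)"
      unfolding V using j by (auto simp: inj_on_def A_def)
    show "CARD('n) \<ge> 2 \<longrightarrow> V_complex I \<noteq> {}" unfolding V using ne by simp
  qed
  then show ?thesis unfolding basis_at_def I_def A_def by blast
qed

section \<open>Local minimizers\<close>

abbreviation gradient_at :: "'n::finite rpoly \<Rightarrow> real ^ 'n \<Rightarrow> real ^ 'n" where
  "gradient_at f x \<equiv> gradient (\<lambda>a. a) x f"

definition hessian_at :: "'n::finite rpoly \<Rightarrow> real ^ 'n \<Rightarrow> real ^ 'n ^ 'n" where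
  "hessian_at f x = map_matrix (\<lambda>p. eval_real p x) (hessian f)"

lemma partial_deriv_commute: "partial_deriv i (partial_deriv k p) = partial_deriv k (partial_deriv i p)"
proof (induction p rule: poly_mapping_add_induct)
  case (single m a)
  have "m - single k 1 - single i 1 = m - single i 1 - single k (1::nat)"
    by (rule poly_mapping_eqI) (simp add: lookup_minus)
  then show ?case
    by (cases "i = k")
      (simp_all add: partial_deriv_single lookup_minus lookup_single mult.left_commute del: One_nat_def)
qed (simp add: partial_deriv_add)

lemma transpose_hessian_at: "transpose (hessian_at f x) = hessian_at f x"
  by (simp add: vec_eq_iff transpose_def hessian_at_def hessian_def partial_deriv_commute)

section \<open>Derivatives along lines\<close>

lemma DERIV_eval_real_line:
  "((\<lambda>t. eval_real f (u + t *\<^sub>R d)) has_real_derivative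
    (\<Sum>i\<in>UNIV. d $ i * eval_real (partial_deriv i f) (u + t *\<^sub>R d))) (at t)"
proof (induction f rule: mpoly_induct)
  case (Const a)
  show ?case by (simp add: eval_real_simps partial_deriv_Const)
next
  case (Var k)
  have "(\<Sum>i\<in>UNIV. d $ i * eval_real (partial_deriv i (Var k)) (u + t *\<^sub>R d)) = (\<Sum>i\<in>UNIV. if i = k then d $ i else 0)"
    by (intro sum.cong) (auto simp: partial_deriv_Var eval_real_simps)
  then show ?case
    by (auto simp: eval_real_simps intro!: derivative_eq_intros)
next
  case (add f g)
  from DERIV_add[OF this] show ?case
    by (simp add: eval_real_simps partial_deriv_add distrib_left sum.distrib)
next
  case (mult f g)
  from DERIV_mult[OF this] show ?case
    by (simp add: eval_real_simps partial_deriv_mult distrib_left sum.distrib sum_distrib_left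
        sum_distrib_right mult_ac)
qed

lemma DERIV_line:
  "((\<lambda>t. eval_real f (u + t *\<^sub>R d)) has_real_derivative gradient_at f (u + t *\<^sub>R d) \<bullet> d) (at t)"
  using DERIV_eval_real_line[where f = f and u = u and d = d and t = t] by (simp add: gradient_def inner_vec_def mult.commute)

lemma DERIV_line_gradient:
  "((\<lambda>t. gradient_at f (u + t *\<^sub>R d) \<bullet> d) has_real_derivative
     d \<bullet> (hessian_at f (u + t *\<^sub>R d) *v d)) (at t)"
proof -
  have "((\<lambda>t. \<Sum>k\<in>UNIV. eval_real (partial_deriv k f) (u + t *\<^sub>R d) * d $ k) has_real_derivative
      (\<Sum>k\<in>UNIV. (\<Sum>i\<in>UNIV. d $ i * eval_real (partial_deriv i (partial_deriv k f)) (u + t *\<^sub>R d)) * d $ k)) (at t)"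
    by (intro DERIV_sum DERIV_cmult_right DERIV_eval_real_line)
  also have "(\<Sum>k\<in>UNIV. (\<Sum>i\<in>UNIV. d $ i * eval_real (partial_deriv i (partial_deriv k f)) (u + t *\<^sub>R d)) * d $ k)
      = d \<bullet> (hessian_at f (u + t *\<^sub>R d) *v d)"
    unfolding sum_distrib_right
    by (subst sum.swap)
      (simp add: inner_vec_def matrix_vector_mult_def hessian_at_def hessian_def sum_distrib_left mult.assoc)
  finally show ?thesis by (simp add: gradient_def inner_vec_def)
qed

lemma continuous_on_eval_real [continuous_intros]:
  "continuous_on S g \<Longrightarrow> continuous_on S (\<lambda>x. eval_real p (g x))"
  unfolding meval_def by (intro continuous_intros)

section \<open>Optimality conditions of first and second order\<close>

lemma local_minimizer_along_line:
  assumes "local_minimizer f u"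
  obtains \<delta> where "\<delta> > 0" "\<And>t. \<bar>t\<bar> < \<delta> \<Longrightarrow> eval_real f u \<le> eval_real f (u + t *\<^sub>R d)"
proof -
  obtain e where e: "e > 0" "\<And>x. norm (x - u) < e \<Longrightarrow> eval_real f u \<le> eval_real f x"
    using assms by (auto simp: local_minimizer_def)
  show thesis
  proof (rule that)
    show "e / (norm d + 1) > 0" using e(1) by (simp add: add_nonneg_pos)
    fix t :: real assume "\<bar>t\<bar> < e / (norm d + 1)"
    then have "\<bar>t\<bar> * (norm d + 1) < e" by (simp add: pos_less_divide_eq add_nonneg_pos)
    then have "\<bar>t\<bar> * norm d < e" by (simp add: distrib_left)
    then show "eval_real f u \<le> eval_real f (u + t *\<^sub>R d)" by (intro e(2)) simp
  qed
qed

lemma gradient_local_minimizer: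
  assumes "local_minimizer f u"
  shows "gradient_at f u = 0"
proof -
  let ?d = "gradient_at f u"
  obtain \<delta> where "\<delta> > 0" "\<And>t. \<bar>t\<bar> < \<delta> \<Longrightarrow> eval_real f u \<le> eval_real f (u + t *\<^sub>R ?d)"
    using local_minimizer_along_line[OF assms] by blast
  with DERIV_local_min[OF DERIV_line[where f = f and u = u and d = ?d and t = 0], of \<delta>] show ?thesis by simp
qed

text \<open>The slope along \<open>d\<close> is 0 at a minimizer, so negative curvature makes it
  negative just after 0. By the mean value theorem \<open>f\<close> then drops arbitrarily close to
  \<open>u\<close>.\<close>

lemma hessian_local_minimizer:
  assumes "local_minimizer f u"
  shows "d \<bullet> (hessian_at f u *v d) \<ge> 0"
proof (rule ccontr)
  let ?g = "\<lambda>t. gradient_at f (u + t *\<^sub>R d) \<bullet> d"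
  assume "\<not> ?thesis"
  then obtain r where r: "r > 0" "\<And>h. 0 < h \<Longrightarrow> h < r \<Longrightarrow> ?g (0 + h) < ?g 0"
    using DERIV_neg_dec_right[OF DERIV_line_gradient[where f = f and u = u and d = d and t = 0]] by auto
  obtain \<delta> where \<delta>: "\<delta> > 0" "\<And>t. \<bar>t\<bar> < \<delta> \<Longrightarrow> eval_real f u \<le> eval_real f (u + t *\<^sub>R d)"
    using local_minimizer_along_line[OF assms] by blast
  define h where "h = min r \<delta> / 2"
  have h: "0 < h" "h < r" "h < \<delta>" using r(1) \<delta>(1) by (auto simp: h_def min_def)
  obtain z where z: "0 < z" "z < h" "eval_real f (u + h *\<^sub>R d) - eval_real f (u + 0 *\<^sub>R d) = (h - 0) * ?g z"
    using MVT2[OF h(1), of "\<lambda>t. eval_real f (u + t *\<^sub>R d)" ?g] DERIV_line by blast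
  have "?g z < 0" using r(2)[of z] z h gradient_local_minimizer[OF assms] by simp
  then have "eval_real f (u + h *\<^sub>R d) < eval_real f u"
    using z(3) h(1) mult_pos_neg[of h "?g z"] by simp
  with \<delta>(2)[of h] h show False by simp
qed

text \<open>An isotropic vector of a semidefinite form lies in the kernel: otherwise a small step
  against \<open>Q *v x\<close> would make the form negative. Nonsingularity leaves only 0.\<close>

lemma pos_defI_of_semidefinite:
  fixes Q :: "real ^ 'n ^ 'n"
  assumes sym: "transpose Q = Q" and psd: "\<And>x. x \<bullet> (Q *v x) \<ge> 0" and det: "det Q \<noteq> 0"
  shows "pos_def Q"
  unfolding pos_def_def
proof (intro conjI allI impI sym)
  fix x :: "real ^ 'n" assume x: "x \<noteq> 0"
  have sym': "y \<bullet> (Q *v x) = x \<bullet> (Q *v y)" for y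
    by (metis dot_lmul_matrix inner_commute sym transpose_matrix_vector)
  show "x \<bullet> (Q *v x) > 0"
  proof (rule ccontr)
    assume "\<not> ?thesis"
    with psd[of x] have 0: "x \<bullet> (Q *v x) = 0" by simp
    define y where "y = Q *v x"
    have expand: "(x + t *\<^sub>R y) \<bullet> (Q *v (x + t *\<^sub>R y)) = t * (2 * (y \<bullet> y) + t * (y \<bullet> (Q *v y)))" for t
      using 0 sym'[of y]
      by (simp add: matrix_vector_right_distrib matrix_vector_mult_scaleR inner_add_left inner_add_right
          algebra_simps flip: y_def)
    have "y \<bullet> y = 0"
    proof (rule ccontr)
      assume "y \<bullet> y \<noteq> 0"
      then have yy: "y \<bullet> y > 0" by simp
      define c where "c = y \<bullet> (Q *v y)"
      have c: "c \<ge> 0" unfolding c_def by (rule psd)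
      \<comment> \<open>Small enough that the quadratic term does not outweigh the linear one; the
        added 1 keeps the denominator positive when \<open>c = 0\<close>.\<close>
      define t where "t = - (y \<bullet> y) / (c + 1)"
      have "t < 0" using yy c by (simp add: t_def divide_neg_pos)
      have "- t * c \<le> y \<bullet> y"
        using yy c by (simp add: t_def field_simps)
      then have "y \<bullet> y + t * c \<ge> 0" by simp
      with yy have "2 * (y \<bullet> y) + t * c > 0" by linarith
      with \<open>t < 0\<close> have "t * (2 * (y \<bullet> y) + t * c) < 0" by (simp add: mult_neg_pos)
      with psd[of "x + t *\<^sub>R y"] show False by (simp add: expand c_def)
    qed
    then have "Q *v x = 0" by (simp add: y_def)
    moreover have "invertible Q" using det by (simp add: invertible_det_nz)
    ultimately have "x = 0"
      by (metis matrix_left_invertible_ker invertible_left_inverse)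
    with x show False ..
  qed
qed

text \<open>The mean value theorem evaluates the Hessian at points near \<open>u\<close>, not at
  \<open>u\<close>. Compactness of the unit sphere, through the tube lemma, extends positivity to a
  ball with one radius for all directions.\<close>

lemma local_minimizer_if_pos_def:
  fixes f :: "'n::finite rpoly"
  assumes grad: "gradient_at f u = 0" and pd: "pos_def (hessian_at f u)"
  shows "local_minimizer f u"
proof -
  let ?F = "\<lambda>(x, d). d \<bullet> (hessian_at f x *v d)"
  let ?S = "sphere 0 1 :: (real ^ 'n) set"
  have "continuous_on UNIV ?F"
    unfolding case_prod_beta inner_vec_def matrix_vector_mult_def hessian_at_def
    by (auto intro!: continuous_intros)
  then have "open {z. ?F z > 0}"
    by (rule open_Collect_less[OF continuous_on_const])
  moreover have "{u} \<times> ?S \<subseteq> {z. ?F z > 0}"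
  proof -
    have "d \<noteq> 0" if "d \<in> ?S" for d using that by auto
    with pd show ?thesis by (auto simp: pos_def_def)
  qed
  ultimately obtain X where X: "u \<in> X" "open X" "X \<times> ?S \<subseteq> {z. ?F z > 0}"
    using Elementary_Topology.tube_lemma[of ?S "{z. ?F z > 0}" u] by auto
  then obtain e where e: "e > 0" "ball u e \<subseteq> X" by (meson open_contains_ball)
  have pos: "d \<bullet> (hessian_at f x *v d) \<ge> 0" if "x \<in> ball u e" for x d
  proof (cases "d = 0")
    case False
    then have "sgn d \<in> ?S" by (simp add: norm_sgn)
    with e(2) that have "(x, sgn d) \<in> X \<times> ?S" by auto
    from subsetD[OF X(3) this] have "sgn d \<bullet> (hessian_at f x *v sgn d) > 0" by simp
    then have "(inverse (norm d))\<^sup>2 * (d \<bullet> (hessian_at f x *v d)) > 0"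
      by (simp add: sgn_div_norm matrix_vector_mult_scaleR power2_eq_square mult.assoc)
    then show ?thesis by (simp add: zero_less_mult_iff)
  qed simp
  have "eval_real f u \<le> eval_real f x" if x: "norm (x - u) < e" for x
  proof -
    define d where "d = x - u"
    let ?g = "\<lambda>t. gradient_at f (u + t *\<^sub>R d) \<bullet> d"
    \<comment> \<open>Two mean value steps replace Taylor's formula: the increment of
      \<open>f\<close> is the slope at \<open>z\<close>, and this slope is \<open>z\<close> times
      the quadratic form at \<open>u + y *\<^sub>R d\<close>.\<close>
    obtain z where z: "0 < z" "z < 1"
      "eval_real f (u + 1 *\<^sub>R d) - eval_real f (u + 0 *\<^sub>R d) = (1 - 0) * ?g z"
      using MVT2[OF zero_less_one, of "\<lambda>t. eval_real f (u + t *\<^sub>R d)" ?g] DERIV_line by blast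
    obtain y where y: "0 < y" "y < z"
      "?g z - ?g 0 = (z - 0) * (d \<bullet> (hessian_at f (u + y *\<^sub>R d) *v d))"
      using MVT2[OF z(1), of ?g "\<lambda>t. d \<bullet> (hessian_at f (u + t *\<^sub>R d) *v d)"] DERIV_line_gradient by blast
    have "norm (y *\<^sub>R d) < e"
    proof -
      have "norm (y *\<^sub>R d) \<le> 1 * norm d"
        using y z by (simp add: mult_right_le_one_le mult_left_le_one_le)
      then show ?thesis using x by (simp add: d_def)
    qed
    then have "u + y *\<^sub>R d \<in> ball u e" by (simp add: dist_norm)
    then have "?g z \<ge> 0" using y z grad pos by simp
    then show ?thesis using z(3) by (simp add: d_def)
  qed
  with e(1) show ?thesis by (auto simp: local_minimizer_def)
qed

lemma local_minimizer_iff: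
  assumes "gradient_at f u = 0 \<Longrightarrow> eval_real (det (hessian f)) u \<noteq> 0"
  shows "local_minimizer f u \<longleftrightarrow> gradient_at f u = 0 \<and> pos_def (hessian_at f u)"
proof
  assume lm: "local_minimizer f u"
  have grad: "gradient_at f u = 0" by (rule gradient_local_minimizer[OF lm])
  with assms have "det (hessian_at f u) \<noteq> 0"
    by (simp add: hessian_at_def eval_real.hom_det)
  then have "pos_def (hessian_at f u)"
    using transpose_hessian_at hessian_local_minimizer[OF lm] by (intro pos_defI_of_semidefinite)
  with grad show "gradient_at f u = 0 \<and> pos_def (hessian_at f u)" by simp
qed (use local_minimizer_if_pos_def in blast)

section \<open>Correctness and termination\<close>

text \<open>Downward induction from \<open>j0\<close> shows that the search succeeds from every
  \<open>j\<close> up to \<open>j0\<close>. It may stop before \<open>j0\<close>, hence the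
  existential conclusion.\<close>

lemma while_option_search:
  fixes P :: "nat \<Rightarrow> bool"
  assumes "P j0"
  shows "\<exists>j. P j \<and> while_option (\<lambda>(j, shape). \<not> shape)
    (\<lambda>(j, shape). if P j then (j, True) else (j + 1, shape)) (0, False) = Some (j, True)"
proof -
  let ?b = "\<lambda>(j :: nat, shape). \<not> shape"
  let ?c = "\<lambda>(j :: nat, shape). if P j then (j, True) else (j + 1, shape)"
  have stop: "while_option ?b ?c (j, True) = Some (j, True)" for j
    by (subst while_option_unfold) simp
  have "\<exists>j'. P j' \<and> while_option ?b ?c (j, False) = Some (j', True)" if "j \<le> j0" for j
    using that
  proof (induction rule: inc_induct)
    case base
    show ?case using assms stop by (subst while_option_unfold) auto
  next
    case (step j)
    then show ?case using stop by (subst while_option_unfold) auto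
  qed
  then show ?thesis by simp
qed

text \<open>\<open>B *v x\<close> is nonzero for nonzero \<open>x\<close>. The converse is the same
  implication for the inverse congruence, by \<open>A\<close>.\<close>

lemma pos_def_congruence:
  fixes Q A B :: "real ^ 'n ^ 'n"
  assumes AB: "A ** B = mat 1" "B ** A = mat 1"
  shows "pos_def (transpose B ** Q ** B) \<longleftrightarrow> pos_def Q"
proof -
  have imp: "pos_def (transpose B ** Q ** B)"
    if Q: "pos_def Q" and AB: "A ** B = mat 1" for Q A B :: "real ^ 'n ^ 'n"
    unfolding pos_def_def
  proof (intro conjI allI impI)
    show "transpose (transpose B ** Q ** B) = transpose B ** Q ** B"
      using Q by (simp add: pos_def_def matrix_transpose_mul matrix_mul_assoc)
    fix x :: "real ^ 'n" assume "x \<noteq> 0"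
    have "A *v (B *v x) = x" by (simp add: matrix_vector_mul_assoc AB)
    with \<open>x \<noteq> 0\<close> have "B *v x \<noteq> 0" by auto
    then have "(B *v x) \<bullet> (Q *v (B *v x)) > 0" using Q by (simp add: pos_def_def)
    also have "(B *v x) \<bullet> (Q *v (B *v x)) = x \<bullet> ((transpose B ** Q ** B) *v x)"
      by (metis dot_lmul_matrix matrix_vector_mul_assoc vector_transpose_matrix)
    finally show "x \<bullet> ((transpose B ** Q ** B) *v x) > 0" .
  qed
  have "transpose A ** (transpose B ** Q ** B) ** A = transpose (B ** A) ** Q ** (B ** A)"
    by (simp add: matrix_transpose_mul matrix_mul_assoc)
  also have "\<dots> = Q" by (simp add: AB transpose_mat)
  finally show ?thesis using imp[of Q A B] imp[of "transpose B ** Q ** B" B A] AB by auto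
qed

text \<open>All generators but the one from \<open>w\<close> express a coordinate through the first,
  so a zero is fixed by its first coordinate, which runs through the real roots of
  \<open>w\<close>.\<close>

lemma V_real_has_shape:
  assumes "has_shape G w v"
  shows "V_real (ideal G) = {\<chi> i. poly (v $ i) t |t. poly w t = 0}"
proof -
  have v1: "v $ first_var = [:0, 1:]"
    and G: "G = insert (in_first_var w) ((\<lambda>i. Var i - in_first_var (v $ i)) ` (- {first_var}))"
    using assms by (auto simp: has_shape_def)
  then have v1_poly: "poly (v $ first_var) t = t" for t by simp
  have ev: "eval_real (in_first_var q) y = poly q (y $ first_var)" for q y
    by (simp add: meval_in_first_var[OF comm_ring_hom_id] map_poly_idI)
  have "y \<in> V_real (ideal G) \<longleftrightarrow>
      poly w (y $ first_var) = 0 \<and> (\<forall>i. i \<noteq> first_var \<longrightarrow> y $ i = poly (v $ i) (y $ first_var))" for y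
    unfolding V_real_ideal G by (auto simp: ev eval_real_simps)
  also have "\<dots> y \<longleftrightarrow> poly w (y $ first_var) = 0 \<and> y = (\<chi> i. poly (v $ i) (y $ first_var))" for y
    by (simp add: vec_eq_iff) (metis v1_poly)
  finally show ?thesis using v1_poly by auto
qed

lemma poly_mod_root:
  fixes w :: "'a::field poly"
  assumes "poly w t = 0"
  shows "poly (h mod w) t = poly h t"
proof -
  have "poly h t = poly (h div w * w + h mod w) t" by simp
  then show ?thesis using assms by (simp only: poly_add poly_mult) simp
qed

text \<open>Reduction modulo \<open>w\<close> changes no value at a root of \<open>w\<close>, and
  composing with \<open>v\<close> before evaluating at \<open>t\<close> amounts to evaluating at
  \<open>v(t)\<close>.\<close>

lemma hessian_mod_shape:
  assumes "poly w t = 0"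
  shows "map_matrix (\<lambda>h. poly h t) (map_matrix (\<lambda>h. h mod w) (map_matrix (meval (\<lambda>a. [:a:]) v) (hessian g)))
    = hessian_at g (\<chi> i. poly (v $ i) t)"
proof -
  have hom: "comm_ring_hom (\<lambda>p :: real poly. poly p t)" by unfold_locales simp_all
  show ?thesis
    by (simp add: vec_eq_iff hessian_at_def poly_mod_root[OF assms]
        hom_meval[OF comm_ring_hom_poly_const hom])
qed

text \<open>Everything rests on the shape and on the basis generating the radical: the points
  \<open>v(t)\<close> are then the real critical points of the transformed polynomial, and the
  inverse of \<open>A\<close> carries them to those of \<open>f\<close>.\<close>

lemma shape_output:
  fixes f :: "'n::{finite,linorder} rpoly"
  assumes shape: "has_shape (basis_at f j) w v"
  defines "A \<equiv> transf_matrix j"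
  shows "{matrix_inv A *v (\<chi> i. poly (v $ i) t) |t. poly w t = 0 \<and>
      pos_def (map_matrix (\<lambda>h. poly h t)
        (map_matrix (\<lambda>h. h mod w) (map_matrix (meval (\<lambda>a. [:a:]) v) (hessian (transform A f)))))}
    = {u. gradient_at f u = 0 \<and> pos_def (hessian_at f u)}" (is "?L = ?R")
proof -
  let ?B = "matrix_inv A"
  let ?g = "transform A f"
  have A: "invertible A" unfolding A_def by (rule invertible_transf_matrix)
  note inv = matrix_inv_inverse[OF A]
  have id: "map_matrix (\<lambda>a. a) M = M" for M :: "real ^ 'n::{finite,linorder} ^ 'n::{finite,linorder}"
    by (simp add: vec_eq_iff)
  have "is_ideal (radical (gradient_ideal ?g))"
    unfolding gradient_ideal_def by (intro is_ideal_radical is_ideal_ideal)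
  then have "V_real (ideal (basis_at f j)) = V_real (gradient_ideal ?g)"
    unfolding basis_at_def A_def by (simp add: ideal_the_reduced_groebner_basis V_real_radical)
  then have V: "{\<chi> i. poly (v $ i) t |t. poly w t = 0} = V_real (gradient_ideal ?g)"
    unfolding V_real_has_shape[OF shape] .
  have grad: "y \<in> V_real (gradient_ideal ?g) \<longleftrightarrow> gradient_at f (?B *v y) = 0" for y
    unfolding mem_V_real_gradient_ideal gradient_transform_eq_0_iff[OF comm_ring_hom_id A] id ..
  have hess: "pos_def (hessian_at ?g y) \<longleftrightarrow> pos_def (hessian_at f (?B *v y))" for y
    unfolding hessian_at_def eval_hessian_transform by (rule pos_def_congruence[OF inv])
  have "?L = {?B *v (\<chi> i. poly (v $ i) t) |t. poly w t = 0 \<and> pos_def (hessian_at ?g (\<chi> i. poly (v $ i) t))}"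
    by (auto simp: hessian_mod_shape)
  also have "\<dots> = (*v) ?B ` {y \<in> {\<chi> i. poly (v $ i) t |t. poly w t = 0}. pos_def (hessian_at ?g y)}"
    by auto
  also have "\<dots> = (*v) ?B ` {y. gradient_at f (?B *v y) = 0 \<and> pos_def (hessian_at f (?B *v y))}"
    unfolding V by (simp add: grad hess)
  also have "\<dots> = ?R"
  proof
    show "?R \<subseteq> (*v) ?B ` {y. gradient_at f (?B *v y) = 0 \<and> pos_def (hessian_at f (?B *v y))}"
    proof
      fix u assume "u \<in> ?R"
      moreover have "?B *v (A *v u) = u" by (simp add: matrix_vector_mul_assoc inv)
      ultimately show "u \<in> (*v) ?B ` {y. gradient_at f (?B *v y) = 0 \<and> pos_def (hessian_at f (?B *v y))}"
        by (intro image_eqI[of u _ "A *v u"]) auto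
    qed
  qed auto
  finally show ?thesis .
qed

theorem proposition3p9:
  fixes f :: "'n::{finite,linorder} rpoly"
  assumes "zero_dimensional (gradient_ideal f)"
    and "\<forall>u \<in> V_real (gradient_ideal f). eval_real (det (hessian f)) u \<noteq> 0"
    and "CARD('n) \<ge> 2 \<longrightarrow> V_complex (gradient_ideal f) \<noteq> {}"
  shows "GRULOM f = Some {u. local_minimizer f u}"
proof -
  obtain j0 where "\<exists>w v. has_shape (basis_at f j0) w v"
    using exists_has_shape[OF assms(1,3)] by blast
  from while_option_search[of "\<lambda>j. \<exists>w v. has_shape (basis_at f j) w v", OF this] obtain j where
    shape: "\<exists>w v. has_shape (basis_at f j) w v"
    and while: "while_option (\<lambda>(j, shape). \<not> shape)
      (\<lambda>(j, shape). if \<exists>w v. has_shape (basis_at f j) w v then (j, True) else (j + 1, shape))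
      (0, False) = Some (j, True)" by blast
  \<comment> \<open>This is the pair chosen by the algorithm; \<open>shape_output\<close> holds for
    every pair of the required shape, hence for this one.\<close>
  define wv where "wv = (SOME (w, v). has_shape (basis_at f j) w v)"
  obtain w v where wv: "wv = (w, v)" by (cases wv)
  have "case wv of (w, v) \<Rightarrow> has_shape (basis_at f j) w v"
    unfolding wv_def by (rule someI_ex) (use shape in simp)
  then have wv_shape: "has_shape (basis_at f j) w v" by (simp add: wv)
  have "{u. local_minimizer f u} = {u. gradient_at f u = 0 \<and> pos_def (hessian_at f u)}"
    using assms(2) by (intro Collect_cong local_minimizer_iff) (simp add: mem_V_real_gradient_ideal)
  then show ?thesis
    unfolding GRULOM_def while by (simp add: Let_def wv shape_output[OF wv_shape] flip: wv_def)
qed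

end
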